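(* Let $m\ge1$, $M=2^m$, let $\mathbb{X}_{\mathrm{PAM}}$ be the $M$-PAM input alphabet and let $\mathbb{L}$ be a binary labeling of order $m$. The constellation $[\mathbb{X}_{\mathrm{PAM}},\mathbb{L},\mathbb{U}_M]$ is first-order optimal (FOO) for BICM if and only if $\mathbb{L}=\mathbb{N}_m$ (the natural binary code), or $\mathbb{L}$ is any other binary labeling that can be derived from $\mathbb{N}_m$ by inverting the bits in certain positions (complementing some columns) and/or by permuting the sequence of bits in all codewords (permuting the columns).
   Context: $M$-PAM. The $M$-PAM input alphabet $\mathbb{X}_{\mathrm{PAM}}$ is the column vector with entries $x_i=-(M-2i-1)$, $i=0,\ldots,M-1$ (dimension $N=1$). Labelings. A binary labeling $\mathbb{L}$ of order $m$ is an $M\times m$ matrix whose rows $\boldsymbol{c}_i=[c_{i,0},\ldots,c_{i,m-1}]$, $i=0,\ldots,M-1$, are the $M$ distinct elements of $\{0,1\}^m$. The natural binary code (NBC) $\mathbb{N}_m$ is the labeling whose row $\boldsymbol{c}_i$ is the base-2 representation of $i$, most significant bit first. Constellations. $\Omega=[\mathbb{X},\mathbb{L},\mathbb{U}_M]$, where $\mathbb{X}$ has rows $\boldsymbol{x}_0,\ldots,\boldsymbol{x}_{M-1}\in\mathbb{R}^N$, denotes the constellation in which the bits $C_0,\ldots,C_{m-1}$ are independent and uniform on $\{0,1\}$ and the transmitted symbol is $\boldsymbol{X}=\boldsymbol{x}_i$ when $[C_0,\ldots,C_{m-1}]=\boldsymbol{c}_i$. Put $E_s=\mathbb{E}[\|\boldsymbol{X}\|^2]$.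 Channel. $\boldsymbol{Y}=\boldsymbol{H}\circ\boldsymbol{X}+\boldsymbol{Z}$, where $\circ$ is the element-wise product, $\boldsymbol{X},\boldsymbol{H},\boldsymbol{Z}$ are mutually independent, $\boldsymbol{Z}$ is Gaussian in $\mathbb{R}^N$ with independent zero-mean components of variance $N_0/2$, and $\boldsymbol{H}$ is a real random vector whose $N$ components (possibly dependent) all have the same distribution, that of a random variable $H$, with $0<\mathbb{E}[H^2]<\infty$. It is assumed that there is $\omega>0$ such that $\Pr\{\|\boldsymbol{H}\|^2>\Delta\}\le\exp(-\Delta^\omega)$ for all sufficiently large $\Delta>0$. $\boldsymbol{H}$ and $N_0$ are known at the receiver. Define $\mathsf{SNR}=\mathbb{E}[H^2]\,E_s/N_0$; the constellation and the law of $\boldsymbol{H}$ are fixed and $N_0$ varies over $(0,\infty)$, so $\mathsf{SNR}\to0$ means $N_0\to\infty$. BICM capacity (in bits). $\mathsf{I}^{\mathrm{BI}}_\Omega(\mathsf{SNR})=\sum_{k=0}^{m-1}\mathbb{E}\left[\log_2\frac{p_{\boldsymbol{Y}|C_k,\boldsymbol{H}}(\boldsymbol{Y})}{p_{\boldsymbol{Y}|\boldsymbol{H}}(\boldsymbol{Y})}\right]$. The coefficient $\alpha^{\mathrm{BI}}_\Omega$ is defined by $\mathsf{I}^{\mathrm{BI}}_\Omega(\mathsf{SNR})=\alpha^{\mathrm{BI}}_\Omega\,\mathsf{SNR}+O(\mathsf{SNR}^2)$ as $\mathsf{SNR}\to 0$. The constellation $\Omega$ is first-order optimal (FOO) for BICM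 if $\alpha^{\mathrm{BI}}_\Omega=\log_2 e$. *)

theory Defs
  imports "HOL-Probability.Probability" "HOL-Library.Landau_Symbols"
    "HOL-Combinatorics.Combinatorics"
begin

text \<open>
  The paper's space \<open>\<real>\<^sup>N\<close> is an arbitrary euclidean space \<open>'a\<close>, whose basis plays the role of
  the coordinates; \<open>N = 1\<close> is the instance \<open>real\<close> (with \<open>Basis = {1}\<close>).
  An alphabet is the list of its rows, and a binary labeling of order \<open>m\<close> is the list of its
  codewords, with bit \<open>True\<close> for 1 and \<open>False\<close> for 0.
\<close>

definition pam :: "nat \<Rightarrow> real list" where
  "pam M = map (\<lambda>i. - (real M - 2 * real i - 1)) [0..<M]"

definition binary_labeling :: "nat \<Rightarrow> bool list list \<Rightarrow> bool" where
  "binary_labeling m L \<longleftrightarrow> length L = 2 ^ m \<and> (\<forall>c\<in>set L. length c = m) \<and> distinct L"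

text \<open>Most significant bit first: \<open>bit i j\<close> is the coefficient of \<open>2 ^ j\<close> in the binary expansion.\<close>

definition nbc :: "nat \<Rightarrow> bool list list" where
  "nbc m = map (\<lambda>i. map (\<lambda>k. bit i (m - 1 - k)) [0..<m]) [0..<2 ^ m]"

definition permute_columns :: "(nat \<Rightarrow> nat) \<Rightarrow> bool list list \<Rightarrow> bool list list" where
  "permute_columns \<pi> L = map (permute_list \<pi>) L"

definition complement_columns :: "nat set \<Rightarrow> bool list list \<Rightarrow> bool list list" where
  "complement_columns S L =
     map (\<lambda>c. map (\<lambda>k. if k \<in> S then \<not> c ! k else c ! k) [0..<length c]) L"

text \<open>The joint law of the bits \<open>(C\<^sub>0, \<dots>, C\<^sub>m\<^sub>-\<^sub>1)\<close>: independent and uniform.\<close>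

definition code_bits :: "nat \<Rightarrow> bool list pmf" where
  "code_bits m = replicate_pmf m (bernoulli_pmf (1 / 2))"

definition symbol :: "'a list \<Rightarrow> bool list list \<Rightarrow> bool list \<Rightarrow> 'a" where
  "symbol X L c = X ! (THE i. i < length L \<and> L ! i = c)"

definition symbol_energy :: "nat \<Rightarrow> 'a::euclidean_space list \<Rightarrow> bool list list \<Rightarrow> real" where
  "symbol_energy m X L = measure_pmf.expectation (code_bits m) (\<lambda>c. (norm (symbol X L c))\<^sup>2)"

definition comp_mult :: "'a::euclidean_space \<Rightarrow> 'a \<Rightarrow> 'a" where
  "comp_mult h x = (\<Sum>b\<in>Basis. ((h \<bullet> b) * (x \<bullet> b)) *\<^sub>R b)"

text \<open>
  \<open>\<nu>\<close> is the law of the fading vector \<open>H\<close>, and \<open>\<eta>\<close> the common law of its components.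
\<close>

definition fading_law :: "'a::euclidean_space measure \<Rightarrow> real measure \<Rightarrow> bool" where
  "fading_law \<nu> \<eta> \<longleftrightarrow>
     prob_space \<nu> \<and> sets \<nu> = sets borel \<and>
     (\<forall>b\<in>Basis. distr \<nu> borel (\<lambda>h. h \<bullet> b) = \<eta>) \<and>
     integrable \<eta> (\<lambda>t. t\<^sup>2) \<and> 0 < (\<integral>t. t\<^sup>2 \<partial>\<eta>) \<and>
     (\<exists>w>0. \<forall>\<^sub>F \<Delta> in at_top. measure \<nu> {h. (norm h)\<^sup>2 > \<Delta>} \<le> exp (- (\<Delta> powr w)))"

text \<open>
  The second argument of \<open>normal_density\<close> is the standard deviation, so each component of the noise
  has variance \<open>N0 / 2\<close>.
\<close>

definition noise_density :: "real \<Rightarrow> 'a::euclidean_space \<Rightarrow> real" where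
  "noise_density N0 z = (\<Prod>b\<in>Basis. normal_density 0 (sqrt (N0 / 2)) (z \<bullet> b))"

definition noise_law :: "real \<Rightarrow> 'a::euclidean_space measure" where
  "noise_law N0 = density lborel (\<lambda>z. ennreal (noise_density N0 z))"

text \<open>
  Density at \<open>y\<close> of the channel output, given \<open>H = h\<close>, when the codeword has law \<open>P\<close>.
\<close>

definition output_density ::
  "'a::euclidean_space list \<Rightarrow> bool list list \<Rightarrow> real \<Rightarrow> bool list pmf \<Rightarrow> 'a \<Rightarrow> 'a \<Rightarrow> real" where
  "output_density X L N0 P h y =
     measure_pmf.expectation P (\<lambda>c. noise_density N0 (y - comp_mult h (symbol X L c)))"

text \<open>The conditional law of the codeword given \<open>C\<^sub>k = u\<close>.\<close>

definition bits_given :: "nat \<Rightarrow> nat \<Rightarrow> bool \<Rightarrow> bool list pmf" where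
  "bits_given m k u = cond_pmf (code_bits m) {c. c ! k = u}"

text \<open>
  The expectation is over the codeword, the fading and the noise, which are independent.
\<close>

definition bicm_capacity ::
  "nat \<Rightarrow> 'a::euclidean_space list \<Rightarrow> bool list list \<Rightarrow> 'a measure \<Rightarrow> real \<Rightarrow> real" where
  "bicm_capacity m X L \<nu> N0 =
     (\<Sum>k<m. \<integral>(c, h, z).
        (let y = comp_mult h (symbol X L c) + z
         in log 2 (output_density X L N0 (bits_given m k (c ! k)) h y /
                   output_density X L N0 (code_bits m) h y))
        \<partial>(measure_pmf (code_bits m) \<Otimes>\<^sub>M \<nu> \<Otimes>\<^sub>M noise_law N0))"

definition snr :: "nat \<Rightarrow> 'a::euclidean_space list \<Rightarrow> bool list list \<Rightarrow> real measure \<Rightarrow> real \<Rightarrow> real" where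
  "snr m X L \<eta> N0 = (\<integral>t. t\<^sup>2 \<partial>\<eta>) * symbol_energy m X L / N0"

text \<open>
  With the constellation and the fading law fixed, \<open>snr\<close> tends to 0 as \<open>N0\<close> tends to infinity.
  At most one \<open>\<alpha>\<close> satisfies the following when the constellation has positive energy.
\<close>

definition bicm_first_order_coeff ::
  "nat \<Rightarrow> 'a::euclidean_space list \<Rightarrow> bool list list \<Rightarrow> 'a measure \<Rightarrow> real measure \<Rightarrow> real \<Rightarrow> bool" where
  "bicm_first_order_coeff m X L \<nu> \<eta> \<alpha> \<longleftrightarrow>
     (\<lambda>N0. bicm_capacity m X L \<nu> N0 - \<alpha> * snr m X L \<eta> N0) \<in> O[at_top](\<lambda>N0. (snr m X L \<eta> N0)\<^sup>2)"

definition bicm_FOO ::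
  "nat \<Rightarrow> 'a::euclidean_space list \<Rightarrow> bool list list \<Rightarrow> 'a measure \<Rightarrow> real measure \<Rightarrow> bool" where
  "bicm_FOO m X L \<nu> \<eta> \<longleftrightarrow> bicm_first_order_coeff m X L \<nu> \<eta> (log 2 (exp 1))"

end

theory Submission
  imports Defs "HOL-Real_Asymp.Real_Asymp"
begin

text \<open>
  Given the fading gain \<open>h\<close>, the output densities relative to the noise density are averages of
  exponentials \<open>exp ((2 a y - a\<^sup>2) / N0)\<close>, and the information carried by bit \<open>k\<close> is a difference of
  expectations of \<open>G ln G\<close> for such averages \<open>G\<close>. Since
  \<open>0 \<le> G ln G - (g + g\<^sup>2 / 2 - g\<^sup>3 / 6) \<le> g\<^sup>4 / 3\<close> with \<open>g = G - 1\<close>, explicit Gaussian moments give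
  \<open>h\<^sup>2 a\<^sub>k\<^sup>2 / N0 + O(h\<^sup>4 / N0\<^sup>2)\<close> nats for bit \<open>k\<close>, where \<open>a\<^sub>k\<close> is the correlation of the symbol with
  the sign \<open>\<sigma>\<^sub>k = \<plusminus>1\<close> of the bit. The error is uniform in \<open>h\<close>, and the tail condition makes \<open>h\<^sup>4\<close>
  integrable, so first-order optimality means \<open>\<Sum>\<^sub>k a\<^sub>k\<^sup>2 = E\<^sub>s\<close>. The signs being orthonormal, this is
  the equality case of Bessel's inequality: the symbol is the linear function \<open>\<Sum>\<^sub>k a\<^sub>k \<sigma>\<^sub>k\<close> of the
  signs. For the equidistant PAM symbols the subset sums of the \<open>\<bar>a\<^sub>k\<bar>\<close> are then \<open>0, \<dots>, 2 ^ m - 1\<close>, each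
  attained once, which forces the \<open>\<bar>a\<^sub>k\<bar>\<close> to be the powers of 2 in some order.
\<close>

subsection \<open>Elementary inequalities\<close>

text \<open>By the signs of the derivative, \<open>f\<close> falls up to 1 and rises afterwards, so
  its minimum is the value 0 at 1.\<close>

lemma nonneg_of_deriv_sign_at_1:
  fixes f f' :: "real \<Rightarrow> real"
  assumes deriv: "\<And>s. s > 0 \<Longrightarrow> (f has_real_derivative f' s) (at s)"
    and right: "\<And>s. s \<ge> 1 \<Longrightarrow> f' s \<ge> 0" and left: "\<And>s. 0 < s \<Longrightarrow> s \<le> 1 \<Longrightarrow> f' s \<le> 0"
    and "f 1 = 0" "t > 0"
  shows "f t \<ge> 0"
proof (cases "t \<ge> 1")
  case True
  have "f 1 \<le> f t"
  proof (rule DERIV_nonneg_imp_nondecreasing[OF True])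
    fix s :: real assume "1 \<le> s" "s \<le> t"
    then show "\<exists>y. (f has_real_derivative y) (at s) \<and> 0 \<le> y"
      using deriv[of s] right[of s] by auto
  qed
  then show ?thesis using assms by simp
next
  case False
  then have "t \<le> 1" by simp
  have "f t \<ge> f 1"
  proof (rule DERIV_nonpos_imp_nonincreasing[OF \<open>t \<le> 1\<close>])
    fix s :: real assume "t \<le> s" "s \<le> 1"
    then show "\<exists>y. (f has_real_derivative y) (at s) \<and> y \<le> 0"
      using deriv[of s] left[of s] \<open>t > 0\<close> by (intro exI[of _ "f' s"]) auto
  qed
  then show ?thesis using assms by simp
qed

text \<open>With \<open>u = s - 1\<close>, the difference of the two sides has derivative
  \<open>1 - u + u^2 - 1 / (1 + u) = u^3 / (1 + u)\<close>, which has the sign of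
  \<open>u\<close>.\<close>

lemma ln_le_cubic:
  fixes t :: real
  assumes "t > 0"
  shows "ln t \<le> (t - 1) - (t - 1)^2 / 2 + (t - 1)^3 / 3"
proof -
  have "0 \<le> (t - 1) - (t - 1)^2 / 2 + (t - 1)^3 / 3 - ln t"
  proof (rule nonneg_of_deriv_sign_at_1[where f' = "\<lambda>s. (s - 1)^3 / s", OF _ _ _ _ assms])
    fix s :: real assume "s > 0"
    then show "((\<lambda>t. (t - 1) - (t - 1)^2 / 2 + (t - 1)^3 / 3 - ln t)
        has_real_derivative (s - 1)^3 / s) (at s)"
      by (auto intro!: derivative_eq_intros simp: field_simps power2_eq_square power3_eq_cube)
  next
    fix s :: real assume "0 < s" "s \<le> 1"
    then show "(s - 1)^3 / s \<le> 0"
      by (intro divide_nonpos_pos) (auto simp: power_le_zero_eq)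
  qed auto
  then show ?thesis by simp
qed

text \<open>The expression vanishes at 1 and is nondecreasing, its derivative being
  \<open>(s - 1)^2 / s\<close>. It is itself the derivative of the lower gap in
  \<open>mult_ln_taylor_bounds\<close>.\<close>

lemma ln_minus_quadratic_sign:
  fixes t :: real
  shows "1 \<le> t \<Longrightarrow> 0 \<le> ln t - (t - 1) + (t - 1)^2 / 2"
    and "0 < t \<Longrightarrow> t \<le> 1 \<Longrightarrow> ln t - (t - 1) + (t - 1)^2 / 2 \<le> 0"
proof -
  let ?k = "\<lambda>t::real. ln t - (t - 1) + (t - 1)^2 / 2"
  have mono: "?k a \<le> ?k b" if "0 < a" "a \<le> b" for a b
  proof (rule DERIV_nonneg_imp_nondecreasing[OF \<open>a \<le> b\<close>])
    fix s assume "a \<le> s" "s \<le> b"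
    with that have s: "s > 0" by simp
    have "(?k has_real_derivative (s - 1)^2 / s) (at s)"
      using s by (auto intro!: derivative_eq_intros simp: field_simps power2_eq_square)
    then show "\<exists>y. (?k has_real_derivative y) (at s) \<and> 0 \<le> y"
      using s by (intro exI[of _ "(s - 1)^2 / s"]) auto
  qed
  show "1 \<le> t \<Longrightarrow> 0 \<le> ?k t" using mono[of 1 t] by simp
  show "0 < t \<Longrightarrow> t \<le> 1 \<Longrightarrow> ?k t \<le> 0" using mono[of t 1] by simp
qed

text \<open>The lower bound follows from the sign of the derivative of the gap. The upper bound is
  \<open>ln_le_cubic\<close> multiplied by \<open>t\<close>: with \<open>g = t - 1\<close>, the
  product \<open>(1 + g) * (g - g^2 / 2 + g^3 / 3)\<close> is exactly the right-hand side.\<close>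

lemma mult_ln_taylor_bounds:
  fixes t :: real
  assumes "t > 0"
  shows "(t - 1) + (t - 1)^2 / 2 - (t - 1)^3 / 6 \<le> t * ln t"
    and "t * ln t \<le> (t - 1) + (t - 1)^2 / 2 - (t - 1)^3 / 6 + (t - 1)^4 / 3"
proof -
  have "0 \<le> t * ln t - ((t - 1) + (t - 1)^2 / 2 - (t - 1)^3 / 6)"
  proof (rule nonneg_of_deriv_sign_at_1
      [where f' = "\<lambda>s. ln s - (s - 1) + (s - 1)^2 / 2", OF _ _ _ _ assms])
    fix s :: real assume "s > 0"
    then show "((\<lambda>t. t * ln t - ((t - 1) + (t - 1)^2 / 2 - (t - 1)^3 / 6))
        has_real_derivative ln s - (s - 1) + (s - 1)^2 / 2) (at s)"
      by (auto intro!: derivative_eq_intros simp: field_simps power2_eq_square)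
  qed (use ln_minus_quadratic_sign in auto)
  then show "(t - 1) + (t - 1)^2 / 2 - (t - 1)^3 / 6 \<le> t * ln t" by simp
  have "t * ln t \<le> t * ((t - 1) - (t - 1)^2 / 2 + (t - 1)^3 / 3)"
    using ln_le_cubic[OF assms] assms by (intro mult_left_mono) auto
  also have "\<dots> = (t - 1) + (t - 1)^2 / 2 - (t - 1)^3 / 6 + (t - 1)^4 / 3"
    by (simp add: field_simps power2_eq_square power3_eq_cube power4_eq_xxxx)
  finally show "t * ln t \<le> (t - 1) + (t - 1)^2 / 2 - (t - 1)^3 / 6 + (t - 1)^4 / 3" .
qed

text \<open>Lagrange form of the remainder, whose intermediate point \<open>t\<close> satisfies
  \<open>\<bar>t\<bar> \<le> \<bar>u\<bar> \<le> R\<close>.\<close>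

lemma exp_remainder_bound:
  fixes u R :: real
  assumes "\<bar>u\<bar> \<le> R"
  shows "\<bar>exp u - 1 - u\<bar> \<le> exp R * u^2"
proof -
  obtain t where t: "\<bar>t\<bar> \<le> \<bar>u\<bar>" "exp u = (\<Sum>m<2. u ^ m / fact m) + exp t / fact 2 * u ^ 2"
    using Maclaurin_exp_le[of u 2] by blast
  have eq: "exp u - 1 - u = exp t / 2 * u^2" using t(2) by (simp add: numeral_2_eq_2)
  have "exp t / 2 \<le> exp R"
    using t(1) assms by (smt (verit) exp_gt_zero exp_le_cancel_iff field_sum_of_halves)
  then have "exp t / 2 * u^2 \<le> exp R * u^2" by (rule mult_right_mono) simp
  then show ?thesis
    unfolding eq by simp
qed

subsection \<open>Moments of the likelihood ratio\<close>

lemma noise_density_real: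
  "noise_density N0 (z::real) = normal_density 0 (sqrt (N0 / 2)) z"
  by (simp add: noise_density_def)

lemma noise_law_real:
  "noise_law N0 = density lborel (\<lambda>z::real. ennreal (normal_density 0 (sqrt (N0 / 2)) z))"
  by (simp add: noise_law_def noise_density_real)

lemma sets_noise_law [measurable_cong, simp]: "sets (noise_law N0) = sets (borel :: real measure)"
  by (simp add: noise_law_real)

lemma space_noise_law [simp]: "space (noise_law N0) = (UNIV :: real set)"
  by (simp add: noise_law_real)

lemma prob_space_noise_law: "N0 > 0 \<Longrightarrow> prob_space (noise_law N0 :: real measure)"
  unfolding noise_law_real by (rule prob_space_normal_density) simp

text \<open>Likelihood ratio at \<open>y\<close> of the Gaussian law of mean \<open>a\<close>
  against the centred one, both of variance \<open>N0 / 2\<close>. Relative to the centred law,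
  output densities become averages of exponentials of affine functions of \<open>y\<close>, whose
  moments are explicit.\<close>

definition likelihood :: "real \<Rightarrow> real \<Rightarrow> real \<Rightarrow> real" where
  "likelihood N0 a y = exp ((2 * a * y - a\<^sup>2) / N0)"

lemma likelihood_pos [simp]: "likelihood N0 a y > 0"
  by (simp add: likelihood_def)

lemma likelihood_measurable [measurable]: "likelihood N0 a \<in> borel_measurable borel"
  unfolding likelihood_def by measurable

lemma noise_density_shift:
  assumes "N0 > 0"
  shows "noise_density N0 (y - a :: real) = noise_density N0 y * likelihood N0 a y"
proof -
  have "- (y - a)\<^sup>2 / N0 = - y\<^sup>2 / N0 + (2 * a * y - a\<^sup>2) / N0"
    using assms by (simp add: field_simps power2_eq_square)
  then show ?thesis
    using assms by (simp add: noise_density_real normal_density_def likelihood_def mult_exp_exp)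
qed

text \<open>Completing the square: the noise density times the exponential is a constant times the
  Gaussian density of mean \<open>b * N0 / 2\<close>.\<close>

lemma has_bochner_integral_noise_law_exp:
  assumes "N0 > 0"
  shows "has_bochner_integral (noise_law N0) (\<lambda>y. exp (b * y + d)) (exp (b\<^sup>2 * N0 / 4 + d))"
proof -
  let ?n = "normal_density 0 (sqrt (N0 / 2))" and ?n' = "normal_density (b * N0 / 2) (sqrt (N0 / 2))"
  have eq: "?n y * exp (b * y + d) = exp (b\<^sup>2 * N0 / 4 + d) * ?n' y" for y
  proof -
    have "- y\<^sup>2 / N0 + (b * y + d) = (b\<^sup>2 * N0 / 4 + d) + - (y - b * N0 / 2)\<^sup>2 / N0"
      using assms by (simp add: field_simps power2_eq_square)
    then have "exp (- y\<^sup>2 / N0) * exp (b * y + d)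
        = exp (b\<^sup>2 * N0 / 4 + d) * exp (- (y - b * N0 / 2)\<^sup>2 / N0)"
      by (metis exp_add)
    then show ?thesis
      using assms by (simp add: normal_density_def)
  qed
  have "has_bochner_integral lborel ?n' 1"
    using assms by (simp add: has_bochner_integral_iff)
  then have "has_bochner_integral lborel (\<lambda>y. ?n y *\<^sub>R exp (b * y + d)) (exp (b\<^sup>2 * N0 / 4 + d))"
    unfolding real_scaleR_def eq
    using has_bochner_integral_mult_right[of "exp (b\<^sup>2 * N0 / 4 + d)" lborel ?n' 1] by simp
  then show ?thesis
    unfolding noise_law_real by (intro has_bochner_integral_density) auto
qed

lemma has_bochner_integral_likelihood:
  assumes "N0 > 0"
  shows "has_bochner_integral (noise_law N0) (likelihood N0 a) 1"
proof -
  have eq: "likelihood N0 a = (\<lambda>y. exp (2 * a / N0 * y + - a\<^sup>2 / N0))"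
    by (simp add: likelihood_def[abs_def] diff_divide_distrib)
  have "(2 * a / N0)\<^sup>2 * N0 / 4 + - a\<^sup>2 / N0 = 0"
    using assms by (simp add: field_simps power2_eq_square)
  then show ?thesis
    using has_bochner_integral_noise_law_exp[OF assms, of "2 * a / N0" "- a\<^sup>2 / N0"]
    unfolding eq by simp
qed

text \<open>The Gaussian integral contributes \<open>(a + b)^2 / N0\<close> to the exponent, and the
  factors themselves contribute \<open>- (a^2 + b^2) / N0\<close>, so only the mixed product
  survives. The same cancellation leaves the pairwise products when there are more factors.\<close>

lemma has_bochner_integral_likelihood2:
  assumes "N0 > 0"
  shows "has_bochner_integral (noise_law N0) (\<lambda>y. likelihood N0 a y * likelihood N0 b y)
    (exp (2 * a * b / N0))"
proof -
  have eq: "likelihood N0 a y * likelihood N0 b y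
      = exp (2 * (a + b) / N0 * y + - (a\<^sup>2 + b\<^sup>2) / N0)" for y
    unfolding likelihood_def mult_exp_exp
    by (rule arg_cong[where f = exp]) (use assms in \<open>simp add: field_simps\<close>)
  have val: "2 * a * b / N0 = (2 * (a + b) / N0)\<^sup>2 * N0 / 4 + - (a\<^sup>2 + b\<^sup>2) / N0"
    using assms by (simp add: field_simps power2_eq_square)
  show ?thesis
    unfolding eq val by (rule has_bochner_integral_noise_law_exp[OF assms])
qed

lemma has_bochner_integral_likelihood3:
  assumes "N0 > 0"
  shows "has_bochner_integral (noise_law N0)
    (\<lambda>y. likelihood N0 a y * likelihood N0 b y * likelihood N0 c y)
    (exp (2 * (a * b + b * c + c * a) / N0))"
proof -
  have eq: "likelihood N0 a y * likelihood N0 b y * likelihood N0 c y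
      = exp (2 * (a + b + c) / N0 * y + - (a\<^sup>2 + b\<^sup>2 + c\<^sup>2) / N0)" for y
    unfolding likelihood_def mult_exp_exp
    by (rule arg_cong[where f = exp]) (use assms in \<open>simp add: field_simps\<close>)
  have val: "2 * (a * b + b * c + c * a) / N0
      = (2 * (a + b + c) / N0)\<^sup>2 * N0 / 4 + - (a\<^sup>2 + b\<^sup>2 + c\<^sup>2) / N0"
    using assms by (simp add: field_simps power2_eq_square)
  show ?thesis
    unfolding eq val by (rule has_bochner_integral_noise_law_exp[OF assms])
qed

text \<open>The constant 12 comes from the six pairs among four equal factors, each pair giving
  \<open>2 * a^2 / N0\<close>.\<close>

lemma has_bochner_integral_likelihood_power4:
  assumes "N0 > 0"
  shows "has_bochner_integral (noise_law N0) (\<lambda>y. likelihood N0 a y ^ 4) (exp (12 * a\<^sup>2 / N0))"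
proof -
  have eq: "likelihood N0 a y ^ 4 = exp (8 * a / N0 * y + - (4 * a\<^sup>2) / N0)" for y
    unfolding likelihood_def exp_of_nat_mult[symmetric]
    by (rule arg_cong[where f = exp]) (use assms in \<open>simp add: field_simps\<close>)
  have val: "12 * a\<^sup>2 / N0 = (8 * a / N0)\<^sup>2 * N0 / 4 + - (4 * a\<^sup>2) / N0"
    using assms by (simp add: field_simps power2_eq_square)
  show ?thesis
    unfolding eq val by (rule has_bochner_integral_noise_law_exp[OF assms])
qed

text \<open>
  In the next three lemmas the terms of first order in \<open>1 / N0\<close> cancel, except in the second moment.
\<close>

lemma has_bochner_integral_likelihood_excess2:
  assumes "N0 > 0"
  shows "has_bochner_integral (noise_law N0)
    (\<lambda>y. (likelihood N0 a y - 1) * (likelihood N0 b y - 1)) (exp (2 * a * b / N0) - 1)"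
proof -
  interpret prob_space "noise_law N0 :: real measure" by (rule prob_space_noise_law[OF assms])
  have one: "has_bochner_integral (noise_law N0) (\<lambda>y::real. 1::real) 1"
    using prob_space by (simp add: has_bochner_integral_iff)
  have "has_bochner_integral (noise_law N0)
    (\<lambda>y. likelihood N0 a y * likelihood N0 b y - likelihood N0 a y - likelihood N0 b y + 1)
    (exp (2 * a * b / N0) - 1 - 1 + 1)"
    by (intro has_bochner_integral_add has_bochner_integral_diff one
        has_bochner_integral_likelihood has_bochner_integral_likelihood2 assms)
  then show ?thesis by (simp add: algebra_simps)
qed

lemma has_bochner_integral_likelihood_excess3:
  assumes "N0 > 0"
  shows "has_bochner_integral (noise_law N0)
    (\<lambda>y. (likelihood N0 a y - 1) * (likelihood N0 b y - 1) * (likelihood N0 c y - 1))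
    (exp (2 * (a * b + b * c + c * a) / N0)
      - exp (2 * a * b / N0) - exp (2 * b * c / N0) - exp (2 * c * a / N0) + 2)"
proof -
  interpret prob_space "noise_law N0 :: real measure" by (rule prob_space_noise_law[OF assms])
  have one: "has_bochner_integral (noise_law N0) (\<lambda>y::real. 1::real) 1"
    using prob_space by (simp add: has_bochner_integral_iff)
  have "has_bochner_integral (noise_law N0)
    (\<lambda>y. likelihood N0 a y * likelihood N0 b y * likelihood N0 c y
      - likelihood N0 a y * likelihood N0 b y - likelihood N0 b y * likelihood N0 c y
      - likelihood N0 c y * likelihood N0 a y
      + likelihood N0 a y + likelihood N0 b y + likelihood N0 c y - 1)
    (exp (2 * (a * b + b * c + c * a) / N0)
      - exp (2 * a * b / N0) - exp (2 * b * c / N0) - exp (2 * c * a / N0) + 1 + 1 + 1 - 1)"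
    by (intro has_bochner_integral_add has_bochner_integral_diff one
        has_bochner_integral_likelihood has_bochner_integral_likelihood2
        has_bochner_integral_likelihood3 assms)
  then show ?thesis by (simp add: algebra_simps)
qed

lemma has_bochner_integral_likelihood_excess_power4:
  assumes "N0 > 0"
  shows "has_bochner_integral (noise_law N0) (\<lambda>y. (likelihood N0 a y - 1) ^ 4)
    (exp (12 * a\<^sup>2 / N0) - 4 * exp (6 * a\<^sup>2 / N0) + 6 * exp (2 * a\<^sup>2 / N0) - 3)"
proof -
  interpret prob_space "noise_law N0 :: real measure" by (rule prob_space_noise_law[OF assms])
  have one: "has_bochner_integral (noise_law N0) (\<lambda>y::real. 1::real) 1"
    using prob_space by (simp add: has_bochner_integral_iff)
  have "has_bochner_integral (noise_law N0)
    (\<lambda>y. likelihood N0 a y ^ 4 - 4 * (likelihood N0 a y * likelihood N0 a y * likelihood N0 a y)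
      + 6 * (likelihood N0 a y * likelihood N0 a y) - 4 * likelihood N0 a y + 1)
    (exp (12 * a\<^sup>2 / N0) - 4 * exp (2 * (a * a + a * a + a * a) / N0)
      + 6 * exp (2 * a * a / N0) - 4 * 1 + 1)"
    by (intro has_bochner_integral_add has_bochner_integral_diff has_bochner_integral_mult_right one
        has_bochner_integral_likelihood has_bochner_integral_likelihood2
        has_bochner_integral_likelihood3 has_bochner_integral_likelihood_power4 assms)
  moreover have "(t - 1) ^ 4 = t ^ 4 - 4 * (t * t * t) + 6 * (t * t) - 4 * t + 1" for t :: real
    by (simp add: algebra_simps power4_eq_xxxx)
  moreover have "exp (12 * a\<^sup>2 / N0) - 4 * exp (2 * (a * a + a * a + a * a) / N0)
      + 6 * exp (2 * a * a / N0) - 4 * 1 + 1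
      = exp (12 * a\<^sup>2 / N0) - 4 * exp (6 * a\<^sup>2 / N0) + 6 * exp (2 * a\<^sup>2 / N0) - 3"
    by (simp add: power2_eq_square mult.assoc)
  ultimately show ?thesis by (simp only:)
qed

subsection \<open>Entropy of a mixture\<close>

lemma abs_average_le:
  fixes f :: "'c \<Rightarrow> real"
  assumes "finite A" "A \<noteq> {}" "\<And>c. c \<in> A \<Longrightarrow> \<bar>f c\<bar> \<le> K"
  shows "\<bar>(\<Sum>c\<in>A. f c) / card A\<bar> \<le> K"
proof -
  have "\<bar>\<Sum>c\<in>A. f c\<bar> \<le> (\<Sum>c\<in>A. K)"
    by (rule order.trans[OF sum_abs sum_mono]) (use assms in auto)
  then show ?thesis
    using assms by (simp add: field_simps card_gt_0_iff)
qed

text \<open>The Cauchy-Schwarz inequality, applied first to \<open>f\<close> and then to its square.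
  It reduces the fourth power of a mixture's excess to those of single likelihood ratios.\<close>

lemma average_power4_le:
  fixes f :: "'c \<Rightarrow> real"
  assumes "finite A" "A \<noteq> {}"
  shows "((\<Sum>c\<in>A. f c) / card A) ^ 4 \<le> (\<Sum>c\<in>A. f c ^ 4) / card A"
proof -
  have n: "real (card A) > 0" using assms by (simp add: card_gt_0_iff)
  have "((\<Sum>c\<in>A. f c)\<^sup>2)\<^sup>2 \<le> ((\<Sum>c\<in>A. (f c)\<^sup>2) * card A)\<^sup>2"
    by (intro power_mono sum_squared_le_sum_of_squares) auto
  also have "\<dots> = (\<Sum>c\<in>A. (f c)\<^sup>2)\<^sup>2 * (real (card A))\<^sup>2" by (simp add: power_mult_distrib)
  also have "\<dots> \<le> ((\<Sum>c\<in>A. ((f c)\<^sup>2)\<^sup>2) * card A) * (real (card A))\<^sup>2"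
    by (intro mult_right_mono sum_squared_le_sum_of_squares) auto
  finally have "(\<Sum>c\<in>A. f c) ^ 4 \<le> (\<Sum>c\<in>A. f c ^ 4) * real (card A) ^ 3"
    by (simp add: power2_eq_square power3_eq_cube power4_eq_xxxx mult.assoc)
  then have "(\<Sum>c\<in>A. f c) ^ 4 / real (card A) ^ 4
      \<le> (\<Sum>c\<in>A. f c ^ 4) * real (card A) ^ 3 / real (card A) ^ 4"
    using n by (intro divide_right_mono) auto
  also have "\<dots> = (\<Sum>c\<in>A. f c ^ 4) / card A"
    using n by (simp add: power3_eq_cube power4_eq_xxxx)
  finally show ?thesis by (simp add: power_divide)
qed

text \<open>Output density relative to the noise density when \<open>c\<close> is uniform on
  \<open>A\<close> and \<open>x c\<close> is the received mean.\<close>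

definition mixture :: "real \<Rightarrow> 'c set \<Rightarrow> ('c \<Rightarrow> real) \<Rightarrow> real \<Rightarrow> real" where
  "mixture N0 A x y = (\<Sum>c\<in>A. likelihood N0 (x c) y) / card A"

lemma mixture_pos: "finite A \<Longrightarrow> A \<noteq> {} \<Longrightarrow> mixture N0 A x y > 0"
  unfolding mixture_def by (intro divide_pos_pos sum_pos) (auto simp: card_gt_0_iff)

lemma mixture_measurable [measurable]: "mixture N0 A x \<in> borel_measurable borel"
  unfolding mixture_def by measurable

lemma mixture_excess:
  assumes "finite A" "A \<noteq> {}"
  shows "mixture N0 A x y - 1 = (\<Sum>c\<in>A. likelihood N0 (x c) y - 1) / card A"
  using assms by (simp add: mixture_def sum_subtractf diff_divide_distrib)

lemma has_bochner_integral_mixture_excess: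
  assumes "N0 > 0" "finite A" "A \<noteq> {}"
  shows "has_bochner_integral (noise_law N0) (\<lambda>y. mixture N0 A x y - 1) 0"
proof -
  interpret prob_space "noise_law N0 :: real measure" by (rule prob_space_noise_law) fact
  have one: "has_bochner_integral (noise_law N0) (\<lambda>y::real. 1::real) 1"
    using prob_space by (simp add: has_bochner_integral_iff)
  have "has_bochner_integral (noise_law N0) (\<lambda>y. (\<Sum>c\<in>A. likelihood N0 (x c) y - 1) / card A)
     ((\<Sum>c\<in>A. 1 - 1) / card A)"
    by (intro has_bochner_integral_divide_zero has_bochner_integral_sum has_bochner_integral_diff
        one has_bochner_integral_likelihood assms(1))
  then show ?thesis
    unfolding mixture_excess[OF assms(2,3)] by simp
qed

text \<open>The square expands into a double average over \<open>A\<close>. Each sum keeps its own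
  division by \<open>card A\<close>, here and for the cube, so that \<open>abs_average_le\<close>
  can later be applied to one average at a time.\<close>

lemma has_bochner_integral_mixture_excess_power2:
  assumes "N0 > 0" "finite A" "A \<noteq> {}"
  shows "has_bochner_integral (noise_law N0) (\<lambda>y. (mixture N0 A x y - 1) ^ 2)
    ((\<Sum>a\<in>A. (\<Sum>b\<in>A. exp (2 * x a * x b / N0) - 1) / card A) / card A)"
proof -
  have "(mixture N0 A x y - 1) ^ 2 = (\<Sum>a\<in>A. (\<Sum>b\<in>A.
      (likelihood N0 (x a) y - 1) * (likelihood N0 (x b) y - 1)) / card A) / card A" for y
    unfolding mixture_excess[OF assms(2,3)]
    by (simp add: power2_eq_square sum_product sum_divide_distrib)
  then show ?thesis
    by (simp only:) (intro has_bochner_integral_divide_zero has_bochner_integral_sum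
        has_bochner_integral_likelihood_excess2 assms(1))
qed

lemma has_bochner_integral_mixture_excess_power3:
  assumes "N0 > 0" "finite A" "A \<noteq> {}"
  shows "has_bochner_integral (noise_law N0) (\<lambda>y. (mixture N0 A x y - 1) ^ 3)
    ((\<Sum>a\<in>A. (\<Sum>b\<in>A. (\<Sum>c\<in>A. exp (2 * (x a * x b + x b * x c + x c * x a) / N0)
      - exp (2 * x a * x b / N0) - exp (2 * x b * x c / N0) - exp (2 * x c * x a / N0) + 2)
      / card A) / card A) / card A)"
proof -
  have "(mixture N0 A x y - 1) ^ 3 = (\<Sum>a\<in>A. (\<Sum>b\<in>A. (\<Sum>c\<in>A.
      (likelihood N0 (x a) y - 1) * (likelihood N0 (x b) y - 1) * (likelihood N0 (x c) y - 1))
      / card A) / card A) / card A" for y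
    unfolding mixture_excess[OF assms(2,3)]
    by (simp add: power3_eq_cube sum_product sum_divide_distrib sum_distrib_left sum_distrib_right
        mult_ac)
  then show ?thesis
    by (simp only:) (intro has_bochner_integral_divide_zero has_bochner_integral_sum
        has_bochner_integral_likelihood_excess3 assms(1))
qed

text \<open>The Taylor bounds place the integrand between the cubic polynomial \<open>?P\<close> and
  \<open>?P + ?Q / 3\<close>, both with explicit integrals. Expanding the exponentials in these
  integrals, the second moment gives twice the squared mean of \<open>x\<close> over
  \<open>N0\<close>; the third and fourth moments have no constant or first-order part and only add
  to the error.\<close>

lemma
  fixes x :: "'c \<Rightarrow> real"
  assumes N0: "N0 > 0" and A: "finite A" "A \<noteq> {}"
  shows integrable_mixture_entropy:
      "integrable (noise_law N0) (\<lambda>y. mixture N0 A x y * ln (mixture N0 A x y))"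
    and integral_mixture_entropy_bound:
      "\<And>B. (\<And>c. c \<in> A \<Longrightarrow> \<bar>x c\<bar> \<le> B) \<Longrightarrow> B\<^sup>2 \<le> N0 \<Longrightarrow>
        \<bar>(\<integral>y. mixture N0 A x y * ln (mixture N0 A x y) \<partial>noise_law N0)
            - ((\<Sum>c\<in>A. x c) / card A)\<^sup>2 / N0\<bar> \<le> 720 * exp 12 * (B\<^sup>2 / N0)\<^sup>2"
proof -
  let ?G = "mixture N0 A x"
  let ?P = "\<lambda>y. (?G y - 1) + (?G y - 1) ^ 2 / 2 - (?G y - 1) ^ 3 / 6"
  let ?Q = "\<lambda>y. (\<Sum>c\<in>A. (likelihood N0 (x c) y - 1) ^ 4) / card A"
  define I2 where "I2 = (\<Sum>a\<in>A. (\<Sum>b\<in>A. exp (2 * x a * x b / N0) - 1) / card A) / card A"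
  define I3 where "I3 = (\<Sum>a\<in>A. (\<Sum>b\<in>A. (\<Sum>c\<in>A.
      exp (2 * (x a * x b + x b * x c + x c * x a) / N0)
      - exp (2 * x a * x b / N0) - exp (2 * x b * x c / N0) - exp (2 * x c * x a / N0) + 2)
      / card A) / card A) / card A"
  define I4 where "I4 = (\<Sum>c\<in>A. exp (12 * (x c)\<^sup>2 / N0) - 4 * exp (6 * (x c)\<^sup>2 / N0)
      + 6 * exp (2 * (x c)\<^sup>2 / N0) - 3) / card A"
  have P: "has_bochner_integral (noise_law N0) ?P (0 + I2 / 2 - I3 / 6)"
    unfolding I2_def I3_def
    by (intro has_bochner_integral_add has_bochner_integral_diff has_bochner_integral_divide_zero
        has_bochner_integral_mixture_excess has_bochner_integral_mixture_excess_power2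
        has_bochner_integral_mixture_excess_power3 assms)
  have Q: "has_bochner_integral (noise_law N0) ?Q I4"
    unfolding I4_def
    by (intro has_bochner_integral_divide_zero has_bochner_integral_sum
        has_bochner_integral_likelihood_excess_power4 assms)
  have lower: "?P y \<le> ?G y * ln (?G y)" and upper: "?G y * ln (?G y) \<le> ?P y + ?Q y / 3" for y
  proof -
    note pos = mixture_pos[OF A, of N0 x y]
    show "?P y \<le> ?G y * ln (?G y)" by (rule mult_ln_taylor_bounds(1)[OF pos])
    have "(?G y - 1) ^ 4 \<le> ?Q y"
      unfolding mixture_excess[OF A] by (rule average_power4_le[OF A])
    then show "?G y * ln (?G y) \<le> ?P y + ?Q y / 3"
      using mult_ln_taylor_bounds(2)[OF pos] by simp
  qed
  show int: "integrable (noise_law N0) (\<lambda>y. ?G y * ln (?G y))"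
  proof (rule Bochner_Integration.integrable_bound)
    show "integrable (noise_law N0) (\<lambda>y. \<bar>?P y\<bar> + \<bar>?Q y\<bar> / 3)"
      by (intro Bochner_Integration.integrable_add integrable_abs integrable_divide_zero
          integrable.intros[OF P] integrable.intros[OF Q])
    show "(\<lambda>y. ?G y * ln (?G y)) \<in> borel_measurable (noise_law N0)" by measurable
    have "norm (?G y * ln (?G y)) \<le> norm (\<bar>?P y\<bar> + \<bar>?Q y\<bar> / 3)" for y
      using lower[of y] upper[of y] by (smt (verit) real_norm_def divide_nonneg_nonneg divide_right_mono)
    then show "AE y in noise_law N0. norm (?G y * ln (?G y)) \<le> norm (\<bar>?P y\<bar> + \<bar>?Q y\<bar> / 3)"
      by simp
  qed
  have ge: "I2 / 2 - I3 / 6 \<le> (\<integral>y. ?G y * ln (?G y) \<partial>noise_law N0)"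
    using integral_mono[of "noise_law N0" ?P "\<lambda>y. ?G y * ln (?G y)"] P int lower
    by (simp add: has_bochner_integral_iff)
  have le: "(\<integral>y. ?G y * ln (?G y) \<partial>noise_law N0) \<le> I2 / 2 - I3 / 6 + I4 / 3"
  proof -
    have "has_bochner_integral (noise_law N0) (\<lambda>y. ?P y + ?Q y / 3) (0 + I2 / 2 - I3 / 6 + I4 / 3)"
      by (intro has_bochner_integral_add has_bochner_integral_divide_zero P Q)
    then show ?thesis
      using integral_mono[of "noise_law N0" "\<lambda>y. ?G y * ln (?G y)" "\<lambda>y. ?P y + ?Q y / 3"] int upper
      by (simp add: has_bochner_integral_iff)
  qed
  fix B assume B: "\<And>c. c \<in> A \<Longrightarrow> \<bar>x c\<bar> \<le> B" "B\<^sup>2 \<le> N0"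
  define r where "r = B\<^sup>2 / N0"
  \<comment> \<open>All exponents below are at most \<open>12 * r \<le> 12\<close> in absolute
    value, so \<open>K\<close> bounds every second-order remainder at once.\<close>
  define K where "K = 144 * exp 12 * r\<^sup>2"
  have r: "0 \<le> r" "r \<le> 1" using B N0 by (auto simp: r_def field_simps)
  have e: "\<bar>exp u - 1 - u\<bar> \<le> K" if "\<bar>u\<bar> \<le> 12 * r" for u :: real
  proof -
    have "\<bar>exp u - 1 - u\<bar> \<le> exp 12 * u\<^sup>2" using that r by (intro exp_remainder_bound) auto
    also have "u\<^sup>2 \<le> (12 * r)\<^sup>2" using that by (metis abs_ge_zero power2_abs power_mono)
    finally show ?thesis by (simp add: K_def power_mult_distrib)
  qed
  have xx: "\<bar>x a * x b\<bar> \<le> B\<^sup>2" if "a \<in> A" "b \<in> A" for a b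
    unfolding abs_mult power2_eq_square using that B by (intro mult_mono) (auto intro: order.trans[OF abs_ge_zero])
  have xr: "\<bar>x a * x b / N0\<bar> \<le> r" if "a \<in> A" "b \<in> A" for a b
    unfolding r_def using xx[OF that] N0 by (simp add: divide_right_mono)
  have "I2 - 2 * (((\<Sum>c\<in>A. x c) / card A)\<^sup>2 / N0)
      = (\<Sum>a\<in>A. (\<Sum>b\<in>A. exp (2 * x a * x b / N0) - 1 - 2 * x a * x b / N0) / card A) / card A"
    by (simp add: I2_def sum_subtractf sum_product sum_divide_distrib power2_eq_square
        diff_divide_distrib sum_distrib_left mult.assoc mult_ac)
  moreover have "\<bar>\<dots>\<bar> \<le> K"
  proof (intro abs_average_le A e)
    fix a b assume "a \<in> A" "b \<in> A"
    from xr[OF this] show "\<bar>2 * x a * x b / N0\<bar> \<le> 12 * r"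
      using r by (simp add: mult.assoc)
  qed
  ultimately have 2: "\<bar>I2 - 2 * (((\<Sum>c\<in>A. x c) / card A)\<^sup>2 / N0)\<bar> \<le> K" by simp
  have 3: "\<bar>I3\<bar> \<le> 4 * K"
    unfolding I3_def
  proof (intro abs_average_le A)
    fix a b c assume abc: "a \<in> A" "b \<in> A" "c \<in> A"
    define p q s where "p = 2 * x a * x b / N0" and "q = 2 * x b * x c / N0"
      and "s = 2 * x c * x a / N0"
    have pqs: "\<bar>p\<bar> \<le> 2 * r" "\<bar>q\<bar> \<le> 2 * r" "\<bar>s\<bar> \<le> 2 * r"
      using xr[of a b] xr[of b c] xr[of c a] abc by (auto simp: p_def q_def s_def mult.assoc)
    have sum: "2 * (x a * x b + x b * x c + x c * x a) / N0 = p + q + s"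
      by (simp add: p_def q_def s_def add_divide_distrib)
    \<comment> \<open>Four exponentials with weights of modulus 1 occur, whence
      \<open>4 * K\<close>. Their constants cancel, \<open>1 - 3 + 2 = 0\<close>, and so do the
      linear terms.\<close>
    have "\<bar>exp (p + q + s) - 1 - (p + q + s)\<bar> \<le> K" "\<bar>exp p - 1 - p\<bar> \<le> K"
      "\<bar>exp q - 1 - q\<bar> \<le> K" "\<bar>exp s - 1 - s\<bar> \<le> K"
      using pqs r by (intro e; linarith)+
    then show "\<bar>exp (2 * (x a * x b + x b * x c + x c * x a) / N0) - exp (2 * x a * x b / N0)
        - exp (2 * x b * x c / N0) - exp (2 * x c * x a / N0) + 2\<bar> \<le> 4 * K"
      unfolding sum p_def[symmetric] q_def[symmetric] s_def[symmetric] by linarith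
  qed
  have 4: "\<bar>I4\<bar> \<le> 11 * K"
    unfolding I4_def
  proof (intro abs_average_le A)
    fix c assume c: "c \<in> A"
    define p where "p = (x c)\<^sup>2 / N0"
    have p: "\<bar>p\<bar> \<le> r" using xr[OF c c] by (simp add: p_def power2_eq_square)
    \<comment> \<open>The weights have absolute sum \<open>1 + 4 + 6 = 11\<close>. The constants
      \<open>1 - 4 + 6 - 3\<close> and the linear coefficients \<open>12 - 24 + 12\<close> both
      vanish.\<close>
    have "\<bar>exp (12 * p) - 1 - 12 * p\<bar> \<le> K" "\<bar>exp (6 * p) - 1 - 6 * p\<bar> \<le> K"
      "\<bar>exp (2 * p) - 1 - 2 * p\<bar> \<le> K"
      using p r by (intro e; linarith)+
    then have "\<bar>exp (12 * p) - 4 * exp (6 * p) + 6 * exp (2 * p) - 3\<bar> \<le> 11 * K" by linarith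
    then show "\<bar>exp (12 * (x c)\<^sup>2 / N0) - 4 * exp (6 * (x c)\<^sup>2 / N0)
        + 6 * exp (2 * (x c)\<^sup>2 / N0) - 3\<bar> \<le> 11 * K"
      by (simp add: p_def)
  qed
  \<comment> \<open>The three errors add up to \<open>K / 2 + 4 * K / 6 + 11 * K / 3\<close>, which
    is less than \<open>5 * K\<close>; and \<open>5 * 144 = 720\<close>.\<close>
  have "\<bar>(\<integral>y. ?G y * ln (?G y) \<partial>noise_law N0) - ((\<Sum>c\<in>A. x c) / card A)\<^sup>2 / N0\<bar> \<le> 5 * K"
    using ge le 2 3 4 by linarith
  then show "\<bar>(\<integral>y. ?G y * ln (?G y) \<partial>noise_law N0) - ((\<Sum>c\<in>A. x c) / card A)\<^sup>2 / N0\<bar>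
      \<le> 720 * exp 12 * (B\<^sup>2 / N0)\<^sup>2"
    by (simp add: K_def r_def)
qed

subsection \<open>Information about one bit\<close>

text \<open>The substitution \<open>y = a + z\<close> turns the noise law into the Gaussian law of
  mean \<open>a\<close>, whose density relative to the noise law is the likelihood ratio.\<close>

lemma
  fixes f :: "real \<Rightarrow> real"
  assumes N0: "N0 > 0" and [measurable]: "f \<in> borel_measurable borel"
  shows integrable_noise_law_shift: "integrable (noise_law N0) (\<lambda>z. f (a + z)) \<longleftrightarrow>
      integrable (noise_law N0) (\<lambda>y. likelihood N0 a y * f y)"
    and integral_noise_law_shift: "(\<integral>z. f (a + z) \<partial>noise_law N0) =
      (\<integral>y. likelihood N0 a y * f y \<partial>noise_law N0)"
proof -
  let ?n = "normal_density 0 (sqrt (N0 / 2))"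
  have eq: "?n (y - a) * f y = ?n y * (likelihood N0 a y * f y)" for y
    using noise_density_shift[OF N0, of y a] by (simp add: noise_density_real)
  have "integrable (noise_law N0) (\<lambda>z. f (a + z))
      \<longleftrightarrow> integrable lborel (\<lambda>z. ?n (a + 1 * z - a) * f (a + 1 * z))"
    by (simp add: noise_law_real integrable_density)
  also have "\<dots> \<longleftrightarrow> integrable lborel (\<lambda>y. ?n (y - a) * f y)"
    by (rule lborel_integrable_real_affine_iff) simp
  also have "\<dots> \<longleftrightarrow> integrable (noise_law N0) (\<lambda>y. likelihood N0 a y * f y)"
    unfolding eq by (simp add: noise_law_real integrable_density)
  finally show "integrable (noise_law N0) (\<lambda>z. f (a + z)) \<longleftrightarrow>
      integrable (noise_law N0) (\<lambda>y. likelihood N0 a y * f y)" .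
  have "(\<integral>z. f (a + z) \<partial>noise_law N0) = (\<integral>z. ?n (a + 1 * z - a) * f (a + 1 * z) \<partial>lborel)"
    by (simp add: noise_law_real integral_density)
  also have "\<dots> = (\<integral>y. ?n (y - a) * f y \<partial>lborel)"
    by (subst (2) lborel_integral_real_affine[of 1 _ a]) auto
  also have "\<dots> = (\<integral>y. likelihood N0 a y * f y \<partial>noise_law N0)"
    unfolding eq by (simp add: noise_law_real integral_density)
  finally show "(\<integral>z. f (a + z) \<partial>noise_law N0) = (\<integral>y. likelihood N0 a y * f y \<partial>noise_law N0)" .
qed

lemma has_bochner_integral_noise_law_square:
  assumes "N0 > 0"
  shows "has_bochner_integral (noise_law N0) (\<lambda>z::real. z\<^sup>2) (N0 / 2)"
proof -
  have val: "fact (2 * 1) / ((2 / (sqrt (N0 / 2))\<^sup>2) ^ 1 * fact 1) = N0 / 2"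
    using assms by (simp add: field_simps)
  have "has_bochner_integral lborel
      (\<lambda>z. normal_density 0 (sqrt (N0 / 2)) z *\<^sub>R z\<^sup>2) (N0 / 2)"
    using normal_moment_even[of "sqrt (N0 / 2)" 0 1] assms
    unfolding val by simp
  then show ?thesis
    unfolding noise_law_real by (intro has_bochner_integral_density) auto
qed

text \<open>At \<open>y = x c + z\<close> every likelihood ratio is at most
  \<open>exp (y^2 / N0)\<close>, while the one of \<open>c\<close> itself equals this maximum times
  \<open>exp (- z^2 / N0)\<close>. This bounds the quotient from below; from above it is at most
  \<open>card A\<close> because the sum over \<open>A'\<close> is part of the sum over
  \<open>A\<close>. The bound does not depend on \<open>x\<close>, so it is uniform in the fading
  gain.\<close>

lemma mixture_ratio_bound:
  fixes x :: "'c \<Rightarrow> real"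
  assumes N0: "N0 > 0" and A: "finite A" and c: "c \<in> A'" and A': "A' \<subseteq> A"
  shows "\<bar>ln (mixture N0 A' x (x c + z) / mixture N0 A x (x c + z))\<bar>
    \<le> ln (real (card A)) + z\<^sup>2 / N0"
proof -
  define y where "y = x c + z"
  have fin: "finite A'" "A' \<noteq> {}" "A \<noteq> {}" using A c A' finite_subset by auto
  have card: "1 \<le> real (card A')" "real (card A') \<le> real (card A)" "1 \<le> real (card A)"
    using fin A card_mono[OF A A'] by (auto simp: Suc_le_eq card_gt_0_iff)
  have pos: "mixture N0 A' x y > 0" "mixture N0 A x y > 0"
    using fin A mixture_pos by auto
  have lik: "likelihood N0 a y = exp (y\<^sup>2 / N0) * exp (- (y - a)\<^sup>2 / N0)" for a
    by (simp add: likelihood_def mult_exp_exp add_divide_distrib[symmetric] power2_eq_square algebra_simps)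
  have up: "mixture N0 A' x y \<le> real (card A) * mixture N0 A x y"
  proof -
    have "0 \<le> (\<Sum>c\<in>A'. likelihood N0 (x c) y)"
      by (intro sum_nonneg) (simp add: less_imp_le)
    then have "mixture N0 A' x y \<le> (\<Sum>c\<in>A'. likelihood N0 (x c) y)"
      unfolding mixture_def using card mult_left_mono[of 1 "real (card A')" "\<Sum>c\<in>A'. likelihood N0 (x c) y"]
      by (simp add: divide_le_eq mult.commute)
    also have "\<dots> \<le> (\<Sum>c\<in>A. likelihood N0 (x c) y)"
      using A A' by (intro sum_mono2) (auto simp: less_imp_le)
    finally show ?thesis unfolding mixture_def using card by simp
  qed
  have "mixture N0 A x y \<le> exp (y\<^sup>2 / N0)"
  proof -
    have "(\<Sum>c\<in>A. likelihood N0 (x c) y) \<le> (\<Sum>c\<in>A. exp (y\<^sup>2 / N0))"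
      unfolding lik using N0 by (intro sum_mono) auto
    then show ?thesis unfolding mixture_def using card by (simp add: field_simps)
  qed
  moreover have "exp (y\<^sup>2 / N0) * exp (- z\<^sup>2 / N0) \<le> real (card A) * mixture N0 A' x y"
  proof -
    have "exp (y\<^sup>2 / N0) * exp (- z\<^sup>2 / N0) = likelihood N0 (x c) y"
      unfolding lik by (simp add: y_def)
    also have "\<dots> \<le> (\<Sum>c\<in>A'. likelihood N0 (x c) y)"
      using fin c by (intro member_le_sum) (auto simp: less_imp_le)
    also have "\<dots> = real (card A') * mixture N0 A' x y" unfolding mixture_def using card by simp
    also have "\<dots> \<le> real (card A) * mixture N0 A' x y"
      using card pos by (intro mult_right_mono) auto
    finally show ?thesis .
  qed
  ultimately have low: "mixture N0 A x y * exp (- z\<^sup>2 / N0) \<le> real (card A) * mixture N0 A' x y"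
    by (smt (verit) exp_gt_zero mult_right_mono)
  have "ln (mixture N0 A' x y) \<le> ln (real (card A) * mixture N0 A x y)"
    using up pos by simp
  moreover have "ln (mixture N0 A x y * exp (- z\<^sup>2 / N0)) \<le> ln (real (card A) * mixture N0 A' x y)"
    using low pos card by (subst ln_le_cancel_iff) auto
  ultimately have "\<bar>ln (mixture N0 A' x y) - ln (mixture N0 A x y)\<bar> \<le> ln (real (card A)) + z\<^sup>2 / N0"
    using pos card N0 by (simp add: ln_mult abs_le_iff) (smt (verit) divide_nonneg_pos zero_le_power2)
  then show ?thesis
    using pos by (simp add: ln_div y_def)
qed

text \<open>Mutual information, in nats, between the bit \<open>p c\<close> and the channel output
  when \<open>c\<close> is uniform on \<open>A\<close> and the received means \<open>x\<close> are
  fixed. The noise density has been cancelled from both output densities.\<close>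

definition bit_information :: "real \<Rightarrow> 'c set \<Rightarrow> ('c \<Rightarrow> bool) \<Rightarrow> ('c \<Rightarrow> real) \<Rightarrow> real" where
  "bit_information N0 A p x = (\<Sum>c\<in>A. \<integral>z. ln (mixture N0 {d\<in>A. p d = p c} x (x c + z) /
     mixture N0 A x (x c + z)) \<partial>noise_law N0) / card A"

lemma integrable_mixture_ratio:
  assumes N0: "N0 > 0" and A: "finite A" and c: "c \<in> A'" and A': "A' \<subseteq> A"
  shows "integrable (noise_law N0)
    (\<lambda>z. ln (mixture N0 A' x (x c + z) / mixture N0 A x (x c + z)))"
proof (rule Bochner_Integration.integrable_bound)
  interpret prob_space "noise_law N0 :: real measure" by (rule prob_space_noise_law[OF N0])
  show "integrable (noise_law N0) (\<lambda>z::real. ln (real (card A)) + z\<^sup>2 / N0)"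
    using integrable.intros[OF has_bochner_integral_noise_law_square[OF N0]] by simp
  show "AE z in noise_law N0. norm (ln (mixture N0 A' x (x c + z) / mixture N0 A x (x c + z)))
      \<le> norm (ln (real (card A)) + z\<^sup>2 / N0)"
    using mixture_ratio_bound[OF assms, of x] by (intro AE_I2) (smt (verit) real_norm_def)
qed measurable

text \<open>The summand \<open>1 / 2\<close> is the expectation of \<open>z^2 / N0\<close> under the
  noise law.\<close>

lemma bit_information_bounded:
  assumes N0: "N0 > 0" and A: "finite A" "A \<noteq> {}"
  shows "\<bar>bit_information N0 A p x\<bar> \<le> ln (real (card A)) + 1 / 2"
  unfolding bit_information_def
proof (intro abs_average_le A)
  fix c assume c: "c \<in> A"
  let ?A' = "{d\<in>A. p d = p c}"
  interpret prob_space "noise_law N0 :: real measure" by (rule prob_space_noise_law[OF N0])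
  note sq = has_bochner_integral_noise_law_square[OF N0]
  have "\<bar>\<integral>z. ln (mixture N0 ?A' x (x c + z) / mixture N0 A x (x c + z)) \<partial>noise_law N0\<bar>
      \<le> (\<integral>z. ln (real (card A)) + z\<^sup>2 / N0 \<partial>noise_law N0)"
    using mixture_ratio_bound[OF N0 A(1), of c ?A' x] c integrable.intros[OF sq]
    by (intro integral_abs_bound_integral integrable_mixture_ratio N0 A) auto
  also have "\<dots> = ln (real (card A)) + 1 / 2"
    using sq N0 prob_space by (simp add: has_bochner_integral_iff)
  finally show "\<bar>\<integral>z. ln (mixture N0 ?A' x (x c + z) / mixture N0 A x (x c + z)) \<partial>noise_law N0\<bar>
      \<le> ln (real (card A)) + 1 / 2" .
qed

text \<open>After the shift to the noise law, the likelihood ratios of the codewords with a given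
  bit value add up to \<open>card A / 2\<close> times the mixture of that half. The logarithm of the
  quotient splits, and the full mixture is the mean of the two halves.\<close>

lemma bit_information_eq:
  fixes x :: "'c \<Rightarrow> real"
  assumes N0: "N0 > 0" and A: "finite A" "A \<noteq> {}"
    and half: "\<And>u. 2 * card {c\<in>A. p c = u} = card A"
  defines "\<Phi> \<equiv> \<lambda>A'. \<integral>y. mixture N0 A' x y * ln (mixture N0 A' x y) \<partial>noise_law N0"
  shows "bit_information N0 A p x
    = (\<Phi> {c\<in>A. p c = True} + \<Phi> {c\<in>A. p c = False}) / 2 - \<Phi> A"
proof -
  let ?A = "\<lambda>u. {c\<in>A. p c = u}"
  let ?f = "\<lambda>u y. ln (mixture N0 (?A u) x y / mixture N0 A x y)"
  have card: "real (card A) > 0" using A by (simp add: card_gt_0_iff)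
  have cardu: "real (card (?A u)) = real (card A) / 2" for u using half[of u] by simp
  have fin: "finite (?A u)" "?A u \<noteq> {}" for u
  proof -
    show "finite (?A u)" using A by simp
    have "card (?A u) \<noteq> 0" using cardu[of u] card by linarith
    then show "?A u \<noteq> {}" by (metis card.empty)
  qed
  have int: "integrable (noise_law N0) (\<lambda>y. likelihood N0 (x c) y * ?f (p c) y)" if "c \<in> A" for c
    using integrable_mixture_ratio[OF N0 A(1), of c "?A (p c)" x] that
    by (subst integrable_noise_law_shift[OF N0, symmetric]) auto
  have pw: "(\<Sum>c\<in>A. likelihood N0 (x c) y * ?f (p c) y)
      = card A * ((mixture N0 (?A True) x y * ln (mixture N0 (?A True) x y)
          + mixture N0 (?A False) x y * ln (mixture N0 (?A False) x y)) / 2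
        - mixture N0 A x y * ln (mixture N0 A x y))" for y
  proof -
    have split: "(\<Sum>c\<in>A. g c) = (\<Sum>c\<in>?A True. g c) + (\<Sum>c\<in>?A False. g c)"
      for g :: "_ \<Rightarrow> real"
      using A by (subst sum.union_disjoint[symmetric]) (auto intro!: sum.cong)
    have sumu: "(\<Sum>c\<in>?A u. likelihood N0 (x c) y) = card A / 2 * mixture N0 (?A u) x y" for u
      unfolding mixture_def cardu using card by simp
    have "(\<Sum>c\<in>A. likelihood N0 (x c) y) = card A * mixture N0 A x y"
      unfolding mixture_def using card by simp
    then have "real (card A) * mixture N0 A x y
        = real (card A) * ((mixture N0 (?A True) x y + mixture N0 (?A False) x y) / 2)"
      unfolding split[of "\<lambda>c. likelihood N0 (x c) y"] sumu
      by (simp add: algebra_simps add_divide_distrib)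
    then have mix: "mixture N0 A x y = (mixture N0 (?A True) x y + mixture N0 (?A False) x y) / 2"
      using card by (metis less_irrefl mult_left_cancel)
    have ln: "?f u y = ln (mixture N0 (?A u) x y) - ln (mixture N0 A x y)" for u
    proof -
      have "mixture N0 (?A u) x y > 0" by (rule mixture_pos[OF fin])
      moreover have "mixture N0 A x y > 0" by (rule mixture_pos[OF A])
      ultimately show ?thesis by (simp add: ln_div)
    qed
    have "(\<Sum>c\<in>A. likelihood N0 (x c) y * ?f (p c) y)
        = (\<Sum>c\<in>?A True. likelihood N0 (x c) y * ?f True y)
          + (\<Sum>c\<in>?A False. likelihood N0 (x c) y * ?f False y)"
      by (subst split) (auto intro!: arg_cong2[where f = "(+)"] sum.cong)
    also have "\<dots> = card A / 2 * mixture N0 (?A True) x y * ?f True y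
        + card A / 2 * mixture N0 (?A False) x y * ?f False y"
      unfolding sum_distrib_right[symmetric] sumu ..
    also have "\<dots> = card A * ((mixture N0 (?A True) x y * ln (mixture N0 (?A True) x y)
          + mixture N0 (?A False) x y * ln (mixture N0 (?A False) x y)) / 2
        - (mixture N0 (?A True) x y + mixture N0 (?A False) x y) / 2 * ln (mixture N0 A x y))"
      unfolding ln by (simp add: algebra_simps add_divide_distrib diff_divide_distrib)
    finally show ?thesis unfolding mix[symmetric] .
  qed
  have "bit_information N0 A p x
      = (\<Sum>c\<in>A. \<integral>y. likelihood N0 (x c) y * ?f (p c) y \<partial>noise_law N0) / card A"
    unfolding bit_information_def
    by (intro arg_cong2[where f = "(/)"] sum.cong refl integral_noise_law_shift N0) measurable
  also have "\<dots> = (\<integral>y. (\<Sum>c\<in>A. likelihood N0 (x c) y * ?f (p c) y) \<partial>noise_law N0) / card A"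
    using int by (subst Bochner_Integration.integral_sum) auto
  also have "\<dots> = (\<Phi> (?A True) + \<Phi> (?A False)) / 2 - \<Phi> A"
  proof -
    have "integrable (noise_law N0) (\<lambda>y. mixture N0 (?A u) x y * ln (mixture N0 (?A u) x y))" for u
      by (rule integrable_mixture_entropy[OF N0 fin])
    from this[of True] this[of False] integrable_mixture_entropy[OF N0 A, of x] show ?thesis
      unfolding pw \<Phi>_def using card
      by (simp add: Bochner_Integration.integral_diff Bochner_Integration.integral_add)
  qed
  finally show ?thesis .
qed

text \<open>If \<open>B^2 \<le> N0\<close>, the entropy expansion applies to \<open>A\<close> and to
  both halves. With \<open>t\<close> the overall mean, the halves have means \<open>t + a\<close>
  and \<open>t - a\<close>, and \<open>((t + a)^2 + (t - a)^2) / 2 - t^2 = a^2\<close>. Otherwise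
  the uniform bound on the information suffices. Covering both cases makes the estimate valid for
  every fading gain, which is what integration over the fading requires.\<close>

lemma bit_information_expansion:
  assumes N0: "N0 > 0" and A: "finite A" "A \<noteq> {}"
    and half: "\<And>u. 2 * card {c\<in>A. p c = u} = card A"
    and B: "\<And>c. c \<in> A \<Longrightarrow> \<bar>x c\<bar> \<le> B"
  shows "\<bar>bit_information N0 A p x - ((\<Sum>c\<in>A. (if p c then x c else - x c)) / card A)\<^sup>2 / N0\<bar>
    \<le> (1440 * exp 12 + ln (real (card A)) + 2) * (B\<^sup>2 / N0)\<^sup>2"
proof -
  let ?A = "\<lambda>u. {c\<in>A. p c = u}"
  define a where "a = (\<Sum>c\<in>A. (if p c then x c else - x c)) / card A"
  define r where "r = B\<^sup>2 / N0"
  have card: "real (card A) \<ge> 1" using A by (simp add: Suc_le_eq card_gt_0_iff)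
  have cardu: "real (card (?A u)) = real (card A) / 2" for u using half[of u] by simp
  have fin: "finite (?A u)" "?A u \<noteq> {}" for u
  proof -
    show "finite (?A u)" using A by simp
    have "card (?A u) \<noteq> 0" using cardu[of u] card by linarith
    then show "?A u \<noteq> {}" by (metis card.empty)
  qed
  have r: "r \<ge> 0" using N0 by (simp add: r_def)
  have l: "ln (real (card A)) \<ge> 0" using card by simp
  show ?thesis
  proof (cases "B\<^sup>2 \<le> N0")
    case True
    let ?m = "\<lambda>A'. (\<Sum>c\<in>A'. x c) / card A'"
    define \<Phi> where "\<Phi> A' = (\<integral>y. mixture N0 A' x y * ln (mixture N0 A' x y) \<partial>noise_law N0)" for A'
    have b: "\<bar>\<Phi> A' - (?m A')\<^sup>2 / N0\<bar> \<le> 720 * exp 12 * r\<^sup>2" if "A' \<subseteq> A" "A' \<noteq> {}" for A'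
      unfolding \<Phi>_def r_def using that B finite_subset[OF _ A(1)] True
      by (intro integral_mixture_entropy_bound N0) auto
    have bu: "\<bar>\<Phi> (?A u) - (?m (?A u))\<^sup>2 / N0\<bar> \<le> 720 * exp 12 * r\<^sup>2" for u
      by (rule b[OF _ fin(2)]) auto
    have split: "(\<Sum>c\<in>A. g c) = (\<Sum>c\<in>?A True. g c) + (\<Sum>c\<in>?A False. g c)"
      for g :: "_ \<Rightarrow> real"
      using A by (subst sum.union_disjoint[symmetric]) (auto intro!: sum.cong)
    have m: "?m (?A True) = ?m A + a" "?m (?A False) = ?m A - a"
      unfolding a_def cardu split[of x] split[of "\<lambda>c. if p c then x c else - x c"]
      using card by (simp_all add: sum_negf field_simps)
    have "a\<^sup>2 / N0 = ((t + a)\<^sup>2 / N0 + (t - a)\<^sup>2 / N0) / 2 - t\<^sup>2 / N0" for t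
      using N0 by (simp add: field_simps power2_eq_square)
    then have q: "a\<^sup>2 / N0 = ((?m (?A True))\<^sup>2 / N0 + (?m (?A False))\<^sup>2 / N0) / 2 - (?m A)\<^sup>2 / N0"
      unfolding m by blast
    have i: "bit_information N0 A p x = (\<Phi> (?A True) + \<Phi> (?A False)) / 2 - \<Phi> A"
      unfolding \<Phi>_def by (rule bit_information_eq[OF N0 A half])
    have combine: "\<bar>i - q\<bar> \<le> 2 * K"
      if "q = (q1 + q0) / 2 - q'" "i = (f1 + f0) / 2 - f"
        "\<bar>f1 - q1\<bar> \<le> K" "\<bar>f0 - q0\<bar> \<le> K" "\<bar>f - q'\<bar> \<le> K"
      for i q q0 q1 q' f f0 f1 K :: real
      using that by (simp add: abs_le_iff field_simps)
    have "\<bar>bit_information N0 A p x - a\<^sup>2 / N0\<bar> \<le> 2 * (720 * exp 12 * r\<^sup>2)"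
      by (rule combine[OF q i bu bu b[OF order.refl A(2)]])
    also have "\<dots> = 1440 * exp 12 * r\<^sup>2" by simp
    also have "\<dots> \<le> (1440 * exp 12 + ln (real (card A)) + 2) * r\<^sup>2"
      using l by (intro mult_right_mono) auto
    finally show ?thesis by (simp add: a_def r_def)
  next
    case False
    \<comment> \<open>Here constants and \<open>r\<close> are both at most multiples of
      \<open>r^2\<close>, so the information and its main term can be bounded separately.\<close>
    then have "r \<ge> 1" using N0 by (simp add: r_def)
    then have r2: "1 \<le> r\<^sup>2" "r \<le> r\<^sup>2" by (auto intro: one_le_power self_le_power)
    have "\<bar>a\<bar> \<le> B" unfolding a_def using B by (intro abs_average_le A) auto
    then have "a\<^sup>2 \<le> B\<^sup>2" by (metis abs_ge_zero power2_abs power_mono)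
    then have "a\<^sup>2 / N0 \<le> r"
      unfolding r_def using N0 by (simp add: divide_right_mono)
    with r2 have "0 \<le> a\<^sup>2 / N0" "a\<^sup>2 / N0 \<le> r\<^sup>2"
      using N0 by auto
    then have "\<bar>bit_information N0 A p x - a\<^sup>2 / N0\<bar> \<le> (ln (real (card A)) + 1 / 2) + 1 * r\<^sup>2"
      using bit_information_bounded[OF N0 A, of p x] by linarith
    also have "\<dots> \<le> (ln (real (card A)) + 1 / 2) * r\<^sup>2 + 1 * r\<^sup>2"
      using r2 l by (intro add_right_mono) (simp add: mult_le_cancel_left1)
    also have "\<dots> = (ln (real (card A)) + 3 / 2) * r\<^sup>2" by (simp add: algebra_simps)
    also have "\<dots> \<le> (1440 * exp 12 + ln (real (card A)) + 2) * r\<^sup>2"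
      by (intro mult_right_mono) (auto simp: add_increasing)
    finally show ?thesis by (simp add: a_def r_def)
  qed
qed

subsection \<open>The capacity as a fading average\<close>

definition codewords :: "nat \<Rightarrow> bool list set" where
  "codewords m = {c. length c = m}"

lemma finite_codewords [simp]: "finite (codewords m)"
  and card_codewords [simp]: "card (codewords m) = 2 ^ m"
  using finite_lists_length_eq[of "UNIV :: bool set" m] card_lists_length_eq[of "UNIV :: bool set" m]
  by (auto simp: codewords_def)

lemma codewords_nonempty [simp]: "codewords m \<noteq> {}"
  by (auto simp: codewords_def intro: exI[of _ "replicate m True"])

text \<open>By induction on the length, each prepended fair bit halves the probability of a
  word.\<close>

lemma code_bits_eq: "code_bits m = pmf_of_set (codewords m)"
proof -
  have "pmf (replicate_pmf m (pmf_of_set (UNIV :: bool set))) xs = of_bool (length xs = m) / 2 ^ m" for xs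
  proof (induction m arbitrary: xs)
    case 0
    show ?case by (cases xs) (auto simp: pmf_return)
  next
    case (Suc m)
    have cons: "pmf (bind_pmf q (\<lambda>ys. return_pmf (x # ys))) xs
        = (case xs of [] \<Rightarrow> 0 | y # ys \<Rightarrow> of_bool (y = x) * pmf q ys)"
      for x :: bool and q :: "bool list pmf"
    proof -
      have "bind_pmf q (\<lambda>ys. return_pmf (x # ys)) = map_pmf ((#) x) q"
        by (simp add: map_pmf_def)
      moreover have "pmf (map_pmf ((#) x) q) (y # ys) = of_bool (y = x) * pmf q ys" for y ys
        by (cases "y = x") (auto simp: pmf_map_inj' inj_def intro!: pmf_map_outside)
      ultimately show ?thesis
        by (cases xs) (auto intro!: pmf_map_outside)
    qed
    have "pmf (replicate_pmf (Suc m) (pmf_of_set UNIV)) xs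
        = (\<integral>x. pmf (bind_pmf (replicate_pmf m (pmf_of_set UNIV)) (\<lambda>ys. return_pmf (x # ys))) xs
            \<partial>measure_pmf (pmf_of_set (UNIV :: bool set)))"
      unfolding replicate_pmf.simps by (rule pmf_bind)
    also have "\<dots> = (\<Sum>x\<in>UNIV. case xs of [] \<Rightarrow> 0
        | y # ys \<Rightarrow> of_bool (y = x) * pmf (replicate_pmf m (pmf_of_set UNIV)) ys) / 2"
      unfolding cons by (subst integral_pmf_of_set) auto
    also have "\<dots> = of_bool (length xs = Suc m) / 2 ^ Suc m"
      unfolding Suc by (cases xs) (auto simp: UNIV_bool)
    finally show ?case .
  qed
  then show ?thesis
    unfolding code_bits_def bernoulli_pmf_half_conv_pmf_of_set
    by (intro pmf_eqI) (simp add: indicator_def, simp add: codewords_def)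
qed

lemma sum_codewords_flip:
  assumes "k < m"
  shows "(\<Sum>c\<in>codewords m. f (c[k := \<not> c ! k])) = (\<Sum>c\<in>codewords m. f c)"
  by (rule sum.reindex_bij_witness[of _ "\<lambda>c. c[k := \<not> c ! k]" "\<lambda>c. c[k := \<not> c ! k]"])
    (use assms in \<open>auto simp: codewords_def\<close>)

text \<open>Flipping bit \<open>k\<close> is an involution that exchanges the two halves.\<close>

lemma card_codewords_bit:
  assumes "k < m"
  shows "2 * card {c\<in>codewords m. c ! k = u} = card (codewords m)"
proof -
  define flip where "flip c = c[k := \<not> c ! k]" for c :: "bool list"
  have flip: "flip (flip c) = c" "flip c \<in> codewords m" "flip c ! k = (\<not> c ! k)"
    if "c \<in> codewords m" for c
    using that assms by (auto simp: flip_def codewords_def)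
  have "bij_betw flip {c\<in>codewords m. c ! k = u} {c\<in>codewords m. c ! k = (\<not> u)}"
    by (rule bij_betw_byWitness[where f' = flip]) (use flip in auto)
  then have "card {c\<in>codewords m. c ! k = u} = card {c\<in>codewords m. c ! k = (\<not> u)}"
    by (rule bij_betw_same_card)
  moreover have "card (codewords m)
      = card {c\<in>codewords m. c ! k = u} + card {c\<in>codewords m. c ! k = (\<not> u)}"
  proof -
    have "codewords m = {c\<in>codewords m. c ! k = u} \<union> {c\<in>codewords m. c ! k = (\<not> u)}" by auto
    then show ?thesis
      by (subst card_Un_disjoint[symmetric]) auto
  qed
  ultimately show ?thesis by simp
qed

lemma codewords_bit_nonempty: "k < m \<Longrightarrow> {c\<in>codewords m. c ! k = u} \<noteq> {}"
  using card_codewords_bit[of k m u] by (metis card.empty card_codewords mult_0_right power_not_zero zero_neq_numeral)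

lemma bits_given_eq:
  assumes "k < m"
  shows "bits_given m k u = pmf_of_set {c\<in>codewords m. c ! k = u}"
proof -
  let ?S = "{c\<in>codewords m. c ! k = u}"
  have ne: "?S \<noteq> {}" by (rule codewords_bit_nonempty[OF assms])
  have int: "codewords m \<inter> {c. c ! k = u} = ?S" by auto
  have cond: "set_pmf (pmf_of_set (codewords m)) \<inter> {c. c ! k = u} \<noteq> {}"
    using ne by (simp add: int)
  have "real (card ?S) = 2 ^ m / 2"
    using arg_cong[OF card_codewords_bit[OF assms, of u], of real] by simp
  then show ?thesis
    unfolding bits_given_def code_bits_eq using ne
    by (intro pmf_eqI) (auto simp: pmf_cond[OF cond] measure_pmf_of_set int indicator_def)
qed

section \<open>Reduction of the capacity integral by Fubini's theorem\<close>

lemma comp_mult_real [simp]: "comp_mult h (x :: real) = h * x"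
  by (simp add: comp_mult_def)

text \<open>The noise density is a common factor of all output densities and cancels in the quotient
  inside the capacity.\<close>

lemma output_density_mixture:
  assumes "N0 > 0" "finite A" "A \<noteq> {}"
  shows "output_density X L N0 (pmf_of_set A) h y
    = noise_density N0 y * mixture N0 A (\<lambda>c. h * symbol X L c) y"
  using assms
  by (simp add: output_density_def integral_pmf_of_set mixture_def noise_density_shift
      sum_distrib_left)

text \<open>The log-ratios are dominated by \<open>ln (real (card ?C)) + z^2 / N0\<close>, which is
  integrable over fading and noise. Fubini's theorem then moves the finite average over codewords
  outside, next the fading, and last the noise; the division by \<open>ln 2\<close> converts nats
  into bits.\<close>

lemma
  fixes \<nu> :: "real measure" and X :: "real list" and L :: "bool list list" and m :: nat
  assumes \<nu>: "prob_space \<nu>" and [measurable_cong]: "sets \<nu> = sets borel" and N0: "N0 > 0"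
  defines "J \<equiv> \<lambda>k h. bit_information N0 (codewords m) (\<lambda>c. c ! k) (\<lambda>c. h * symbol X L c)"
  shows integrable_bit_information_fading: "integrable \<nu> (J k)"
    and bicm_capacity_eq: "bicm_capacity m X L \<nu> N0 = (\<Sum>k<m. \<integral>h. J k h \<partial>\<nu>) / ln 2"
proof -
  interpret \<nu>: prob_space \<nu> by fact
  interpret noise: prob_space "noise_law N0 :: real measure" by (rule prob_space_noise_law[OF N0])
  interpret Q: pair_prob_space \<nu> "noise_law N0 :: real measure" ..
  interpret P: pair_prob_space "measure_pmf (code_bits m)" "\<nu> \<Otimes>\<^sub>M (noise_law N0 :: real measure)" ..
  let ?s = "symbol X L"
  let ?C = "codewords m"
  define G where "G k c = (\<lambda>(h, z).
      ln (mixture N0 {d\<in>?C. d ! k = c ! k} (\<lambda>d. h * ?s d) (h * ?s c + z)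
        / mixture N0 ?C (\<lambda>d. h * ?s d) (h * ?s c + z)))" for k c
  have G_meas [measurable]: "G k c \<in> borel_measurable (\<nu> \<Otimes>\<^sub>M noise_law N0)" for k c
    unfolding G_def mixture_def likelihood_def by measurable
  have G_bound: "\<bar>G k c (h, z)\<bar> \<le> ln (real (card ?C)) + z\<^sup>2 / N0" if "c \<in> ?C" for k c h z
    unfolding G_def prod.case
    by (rule mixture_ratio_bound[OF N0 finite_codewords, where x = "\<lambda>d. h * ?s d"])
      (use that in auto)
  have int_sq: "integrable (noise_law N0) (\<lambda>z::real. ln (real (card ?C)) + z\<^sup>2 / N0)"
    using integrable.intros[OF has_bochner_integral_noise_law_square[OF N0]] by simp
  have int_bound: "integrable (\<nu> \<Otimes>\<^sub>M noise_law N0) (\<lambda>(h, z). ln (real (card ?C)) + z\<^sup>2 / N0)"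
    by (rule Q.Fubini_integrable) (use int_sq in auto)
  have G_int: "integrable (\<nu> \<Otimes>\<^sub>M noise_law N0) (G k c)" if "c \<in> ?C" for k c
    by (rule Bochner_Integration.integrable_bound[OF int_bound])
      (auto intro!: AE_I2 order.trans[OF G_bound[OF that]])
  have J_eq: "J k h = (\<Sum>c\<in>?C. \<integral>z. G k c (h, z) \<partial>noise_law N0) / card ?C" for k h
    by (simp add: J_def bit_information_def G_def)
  have int_z: "integrable \<nu> (\<lambda>h. \<integral>z. G k c (h, z) \<partial>noise_law N0)" if "c \<in> ?C" for k c
    by (rule Q.integrable_fst'[OF G_int[OF that]])
  show "integrable \<nu> (J k)" unfolding J_eq using int_z by auto
  have per_bit: "(\<integral>(c, h, z). (let y = comp_mult h (?s c) + z
         in log 2 (output_density X L N0 (bits_given m k (c ! k)) h y /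
                   output_density X L N0 (code_bits m) h y))
        \<partial>(measure_pmf (code_bits m) \<Otimes>\<^sub>M \<nu> \<Otimes>\<^sub>M noise_law N0)) = (\<integral>h. J k h \<partial>\<nu>) / ln 2"
    if "k < m" for k
  proof -
    let ?F = "\<lambda>p. G k (fst p) (snd p) / ln 2"
    have "(\<lambda>(c, h, z). (let y = comp_mult h (?s c) + z
         in log 2 (output_density X L N0 (bits_given m k (c ! k)) h y /
                   output_density X L N0 (code_bits m) h y))) = ?F"
    proof (rule ext, clarify)
      fix c h z
      have "noise_density N0 (h * ?s c + z) \<noteq> 0"
        using normal_density_pos[of "sqrt (N0 / 2)" 0 "h * ?s c + z"] N0
        by (simp add: noise_density_real)
      then show "(let y = comp_mult h (?s c) + z
         in log 2 (output_density X L N0 (bits_given m k (c ! k)) h y /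
                   output_density X L N0 (code_bits m) h y)) = ?F (c, h, z)"
        using codewords_bit_nonempty[OF that]
        by (simp add: bits_given_eq[OF that] code_bits_eq output_density_mixture[OF N0] G_def log_def Let_def)
    qed
    moreover have "integral\<^sup>L (measure_pmf (code_bits m) \<Otimes>\<^sub>M \<nu> \<Otimes>\<^sub>M noise_law N0) ?F
        = (\<integral>h. J k h \<partial>\<nu>) / ln 2"
    proof -
      have meas [measurable]:
        "?F \<in> borel_measurable (measure_pmf (code_bits m) \<Otimes>\<^sub>M \<nu> \<Otimes>\<^sub>M noise_law N0)"
      proof -
        \<comment> \<open>There are only countably many bit lists, so measurability in fading and
          noise for each fixed list is enough.\<close>
        have "?F \<in> borel_measurable (count_space UNIV \<Otimes>\<^sub>M (\<nu> \<Otimes>\<^sub>M noise_law N0))"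
          by (rule measurable_pair_measure_countable1) auto
        then show ?thesis
          by (subst measurable_cong_sets[OF sets_pair_measure_cong[OF sets_measure_pmf_count_space refl] refl])
      qed
      have supp: "set_pmf (code_bits m) = ?C" by (simp add: code_bits_eq)
      have int: "integrable (measure_pmf (code_bits m) \<Otimes>\<^sub>M \<nu> \<Otimes>\<^sub>M noise_law N0) ?F"
      proof (rule P.Fubini_integrable[OF meas])
        show "integrable (measure_pmf (code_bits m))
            (\<lambda>c. \<integral>q. norm (?F (c, q)) \<partial>(\<nu> \<Otimes>\<^sub>M noise_law N0))"
          by (rule integrable_measure_pmf_finite) (simp add: supp)
        show "AE c in measure_pmf (code_bits m).
            integrable (\<nu> \<Otimes>\<^sub>M noise_law N0) (\<lambda>q. ?F (c, q))"
          using G_int by (auto simp: AE_measure_pmf_iff supp)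
      qed
      have "integral\<^sup>L (measure_pmf (code_bits m) \<Otimes>\<^sub>M \<nu> \<Otimes>\<^sub>M noise_law N0) ?F
          = (\<integral>c. (\<integral>q. ?F (c, q) \<partial>(\<nu> \<Otimes>\<^sub>M noise_law N0)) \<partial>measure_pmf (code_bits m))"
        by (rule P.integral_fst'[OF int, symmetric])
      also have "\<dots> = (\<Sum>c\<in>?C. (\<integral>q. G k c q \<partial>(\<nu> \<Otimes>\<^sub>M noise_law N0)) / ln 2) / card ?C"
        unfolding code_bits_eq by (subst integral_pmf_of_set) auto
      also have "\<dots> = (\<Sum>c\<in>?C. (\<integral>h. (\<integral>z. G k c (h, z) \<partial>noise_law N0) \<partial>\<nu>) / ln 2) / card ?C"
        by (intro arg_cong2[where f = "(/)"] sum.cong refl Q.integral_fst'[symmetric] G_int)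
      also have "\<dots> = (\<integral>h. J k h \<partial>\<nu>) / ln 2"
        unfolding J_eq using int_z by (simp add: sum_divide_distrib[symmetric])
      finally show ?thesis .
    qed
    ultimately show ?thesis by simp
  qed
  show "bicm_capacity m X L \<nu> N0 = (\<Sum>k<m. \<integral>h. J k h \<partial>\<nu>) / ln 2"
    unfolding bicm_capacity_def sum_divide_distrib by (intro sum.cong refl per_bit) simp
qed

subsection \<open>Labelings with affine symbols\<close>

lemma nbc_nth: "i < 2 ^ m \<Longrightarrow> k < m \<Longrightarrow> nbc m ! i ! k = bit i (m - 1 - k)"
  by (simp add: nbc_def)

lemma length_nbc [simp]: "length (nbc m) = 2 ^ m"
  by (simp add: nbc_def)

lemma length_nbc_nth: "i < 2 ^ m \<Longrightarrow> length (nbc m ! i) = m"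
  by (simp add: nbc_def)

lemma transformed_nbc_nth:
  assumes "\<pi> permutes {..<m}" "i < 2 ^ m" "k < m"
  shows "complement_columns S (permute_columns \<pi> (nbc m)) ! i ! k
    \<longleftrightarrow> bit i (m - 1 - \<pi> k) \<noteq> (k \<in> S)"
proof -
  have "\<pi> k < m" using permutes_in_image[OF assms(1), of k] assms by simp
  then show ?thesis
    using assms by (auto simp: complement_columns_def permute_columns_def length_nbc_nth
        permute_list_nth nbc_nth)
qed

lemma eq_transformed_nbc_iff:
  assumes L: "length L = 2 ^ m" "\<forall>c\<in>set L. length c = m"
    and \<pi>: "\<pi> permutes {..<m}"
  shows "L = complement_columns S (permute_columns \<pi> (nbc m))
    \<longleftrightarrow> (\<forall>i<2 ^ m. \<forall>k<m. L ! i ! k \<longleftrightarrow> bit i (m - 1 - \<pi> k) \<noteq> (k \<in> S))"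
    (is "L = ?T \<longleftrightarrow> _")
proof -
  have T: "length ?T = 2 ^ m" "\<And>i. i < 2 ^ m \<Longrightarrow> length (?T ! i) = m"
    by (auto simp: complement_columns_def permute_columns_def length_nbc_nth)
  have "\<And>i. i < 2 ^ m \<Longrightarrow> length (L ! i) = m" using L by auto
  then have "L = ?T \<longleftrightarrow> (\<forall>i<2 ^ m. \<forall>k<m. L ! i ! k = ?T ! i ! k)"
    using L T by (auto simp: list_eq_iff_nth_eq)
  then show ?thesis using transformed_nbc_nth[OF \<pi>] by auto
qed

lemma sum_bits_nat:
  assumes "i < 2 ^ m"
  shows "(\<Sum>j<m. if bit i j then 2 ^ j else 0) = (i :: nat)"
proof -
  have "i = take_bit m i" using assms by (simp add: take_bit_nat_eq_self)
  also have "\<dots> = (\<Sum>j<m. if bit i j then 2 ^ j else 0)"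
    unfolding take_bit_sum atLeast0LessThan by (intro sum.cong) (auto simp: push_bit_eq_mult)
  finally show ?thesis by simp
qed

lemma sum_bits_real:
  assumes "i < 2 ^ m"
  shows "(\<Sum>j<m. if bit i j then 2 ^ j else 0) = real i"
  using arg_cong[OF sum_bits_nat[OF assms], of real] by (simp add: if_distrib cong: if_cong)

text \<open>
  If the subset sums of \<open>\<beta>\<close> are distinct and fill an initial segment, the powers of 2 have to occur
  one after the other among the values of \<open>\<beta>\<close>: the powers below \<open>2 ^ j\<close> account for all smaller
  sums, so that a set of sum \<open>2 ^ j\<close> contains a new index, whose value cannot be smaller than \<open>2 ^ j\<close>.
\<close>

lemma subset_sums_powers_of_2:
  fixes \<beta> :: "nat \<Rightarrow> real"
  assumes nonneg: "\<And>k. k < m \<Longrightarrow> \<beta> k \<ge> 0"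
    and inj: "\<And>T T'. T \<subseteq> {..<m} \<Longrightarrow> T' \<subseteq> {..<m} \<Longrightarrow> sum \<beta> T = sum \<beta> T' \<Longrightarrow> T = T'"
    and surj: "\<And>i. i < 2 ^ m \<Longrightarrow> \<exists>T\<subseteq>{..<m}. sum \<beta> T = real i"
    and nat: "\<And>T. T \<subseteq> {..<m} \<Longrightarrow> \<exists>i. sum \<beta> T = real i"
    and "j < m"
  shows "\<exists>k<m. \<beta> k = 2 ^ j"
  using \<open>j < m\<close>
proof (induction j rule: less_induct)
  case (less j)
  then have "\<forall>l\<in>{..<j}. \<exists>k<m. \<beta> k = 2 ^ l" by auto
  then obtain \<kappa> where \<kappa>: "\<And>l. l < j \<Longrightarrow> \<kappa> l < m" "\<And>l. l < j \<Longrightarrow> \<beta> (\<kappa> l) = 2 ^ l"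
    by (metis lessThan_iff)
  have inj_\<kappa>: "inj_on \<kappa> {..<j}"
    by (rule inj_onI) (metis \<kappa>(2) lessThan_iff one_less_numeral_iff power_inject_exp semiring_norm(76))
  let ?K = "\<kappa> ` {..<j}"
  have K: "?K \<subseteq> {..<m}" using \<kappa> by auto
  have sumK: "sum \<beta> (\<kappa> ` T) = (\<Sum>l\<in>T. 2 ^ l)" if "T \<subseteq> {..<j}" for T
    using that \<kappa> inj_on_subset[OF inj_\<kappa> that] by (subst sum.reindex) (auto intro!: sum.cong)
  have small: "\<exists>T\<subseteq>?K. sum \<beta> T = real i" if "i < 2 ^ j" for i
  proof (intro exI conjI)
    \<comment> \<open>The binary digits of \<open>i\<close> select the indices that carry the
      required powers of 2.\<close>
    let ?T = "{l\<in>{..<j}. bit i l}"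
    show "\<kappa> ` ?T \<subseteq> ?K" by auto
    have "sum \<beta> (\<kappa> ` ?T) = (\<Sum>l\<in>?T. 2 ^ l)" by (rule sumK) auto
    also have "\<dots> = (\<Sum>l<j. if bit i l then 2 ^ l else 0)"
      by (rule sum.inter_filter) simp
    finally show "sum \<beta> (\<kappa> ` ?T) = real i" using sum_bits_real[OF that] by simp
  qed
  have "(2 ^ j :: nat) < 2 ^ m" using less.prems by simp
  from surj[OF this] obtain T where T: "T \<subseteq> {..<m}" "sum \<beta> T = 2 ^ j" by auto
  have fin: "finite T" "finite ?K" using T finite_subset by auto
  have "\<not> T \<subseteq> ?K"
  proof
    assume "T \<subseteq> ?K"
    then have "sum \<beta> T \<le> sum \<beta> ?K"
      using K nonneg by (intro sum_mono2) auto
    also have "\<dots> = (\<Sum>l<j. 2 ^ l)" by (rule sumK) auto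
    also have "\<dots> = 2 ^ j - (1::real)" by (simp add: geometric_sum)
    finally show False using T by simp
  qed
  then obtain k where k: "k \<in> T" "k \<notin> ?K" by auto
  have "k < m" using k T by auto
  have "\<beta> k \<le> sum \<beta> T"
    using k T nonneg fin by (intro member_le_sum) auto
  moreover have "\<not> \<beta> k < 2 ^ j"
  proof
    assume "\<beta> k < 2 ^ j"
    \<comment> \<open>An integral value below \<open>2 ^ j\<close> is already a subset sum over
      \<open>?K\<close>; distinctness of subset sums would then place \<open>k\<close> in
      \<open>?K\<close>.\<close>
    moreover obtain i where i: "\<beta> k = real i" using nat[of "{k}"] \<open>k < m\<close> by auto
    ultimately have "i < 2 ^ j" by (metis of_nat_less_iff of_nat_numeral of_nat_power)
    from small[OF this] obtain T' where "T' \<subseteq> ?K" "sum \<beta> T' = sum \<beta> {k}" using i by auto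
    with K have "T' = {k}" using \<open>k < m\<close> by (intro inj) auto
    with k \<open>T' \<subseteq> ?K\<close> show False by auto
  qed
  ultimately show ?case using T \<open>k < m\<close> by (intro exI[of _ k]) auto
qed

text \<open>Complementing the columns with negative coefficient makes all coefficients nonnegative,
  and each symbol becomes twice a subset sum minus the total. The subset sums turn out to be the row
  indices, so the coefficients are the powers of 2 and each column carries one binary digit of the
  row index.\<close>

lemma affine_labeling_imp_transformed_nbc:
  fixes L :: "bool list list" and b :: "nat \<Rightarrow> real"
  assumes L: "binary_labeling m L"
    and b: "\<And>i. i < 2 ^ m \<Longrightarrow> 2 * real i + 1 - 2 ^ m = (\<Sum>k<m. if L ! i ! k then b k else - b k)"
  shows "\<exists>S \<pi>. S \<subseteq> {..<m} \<and> \<pi> permutes {..<m} \<and>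
     L = complement_columns S (permute_columns \<pi> (nbc m))"
proof -
  have len: "length L = 2 ^ m" "\<forall>c\<in>set L. length c = m"
    using L by (auto simp: binary_labeling_def)
  define S where "S = {k. k < m \<and> b k < 0}"
  define \<beta> where "\<beta> k = \<bar>b k\<bar>" for k
  define U where "U i = {k. k < m \<and> (L ! i ! k \<noteq> (k \<in> S))}" for i
  have U: "U i \<subseteq> {..<m}" for i by (auto simp: U_def)
  have sumU: "2 * real i + 1 - 2 ^ m = 2 * sum \<beta> (U i) - sum \<beta> {..<m}" if "i < 2 ^ m" for i
  proof -
    have "(\<Sum>k<m. if L ! i ! k then b k else - b k)
        = (\<Sum>k<m. 2 * (if k \<in> U i then \<beta> k else 0) - \<beta> k)"
      by (intro sum.cong refl) (auto simp: \<beta>_def U_def S_def)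
    also have "\<dots> = 2 * (\<Sum>k<m. if k \<in> U i then \<beta> k else 0) - sum \<beta> {..<m}"
      by (simp add: sum_subtractf sum_distrib_left)
    also have "(\<Sum>k<m. if k \<in> U i then \<beta> k else 0) = sum \<beta> (U i)"
      using U[of i] by (simp add: sum.inter_restrict[symmetric] Int_absorb1)
    finally show ?thesis using b[OF that] by simp
  qed
  \<comment> \<open>Equal subsets would give equal symbols, hence equal indices. Counting then shows
    that every subset of the columns occurs.\<close>
  have inj_U: "inj_on U {..<2 ^ m}"
  proof (rule inj_onI)
    fix i i' :: nat assume i: "i \<in> {..<2 ^ m}" "i' \<in> {..<2 ^ m}" and "U i = U i'"
    then have "real i = real i'" using sumU[of i] sumU[of i'] by simp
    then show "i = i'" by simp
  qed
  have "U ` {..<2 ^ m} = Pow {..<m}"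
  proof (rule card_subset_eq)
    show "U ` {..<2 ^ m} \<subseteq> Pow {..<m}" using U by auto
    show "card (U ` {..<2 ^ m}) = card (Pow {..<m})"
      using card_image[OF inj_U] by (simp add: card_Pow)
  qed auto
  then have ex: "\<exists>i<2 ^ m. T = U i" if "T \<subseteq> {..<m}" for T
    using that by (metis (no_types, lifting) PowI imageE lessThan_iff)
  \<comment> \<open>The index \<open>i\<close> of the empty subset satisfies
    \<open>sum \<beta> (U 0) = - real i\<close>; since the sum is nonnegative, \<open>i = 0\<close>.
    This fixes the total as \<open>2 ^ m - 1\<close>, and the subset sums become the indices
    themselves.\<close>
  have "U 0 = {}"
  proof -
    obtain i where i: "i < 2 ^ m" "U i = {}" using ex[of "{}"] by auto
    have "0 \<le> sum \<beta> (U 0)" by (intro sum_nonneg) (simp add: \<beta>_def)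
    then have "real i \<le> 0" using sumU[OF i(1)] sumU[of 0] i by simp
    then show ?thesis using i by simp
  qed
  then have "sum \<beta> {..<m} = 2 ^ m - 1" using sumU[of 0] by simp
  then have sumU': "sum \<beta> (U i) = real i" if "i < 2 ^ m" for i
    using sumU[OF that] by simp
  have inj: "T = T'" if T: "T \<subseteq> {..<m}" "T' \<subseteq> {..<m}" "sum \<beta> T = sum \<beta> T'" for T T'
  proof -
    obtain i i' where "i < 2 ^ m" "T = U i" "i' < 2 ^ m" "T' = U i'"
      using ex[OF T(1)] ex[OF T(2)] by blast
    with T sumU' show ?thesis by auto
  qed
  have "\<exists>k<m. \<beta> k = 2 ^ j" if "j < m" for j
  proof (rule subset_sums_powers_of_2[OF _ inj _ _ that])
    show "\<exists>T\<subseteq>{..<m}. sum \<beta> T = real i" if "i < 2 ^ m" for i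
      using sumU'[OF that] U by blast
    show "\<exists>i. sum \<beta> T = real i" if "T \<subseteq> {..<m}" for T
      using ex[OF that] sumU' by auto
  qed (auto simp: \<beta>_def)
  then obtain \<kappa> where \<kappa>: "\<And>j. j < m \<Longrightarrow> \<kappa> j < m" "\<And>j. j < m \<Longrightarrow> \<beta> (\<kappa> j) = 2 ^ j"
    by metis
  have inj_\<kappa>: "inj_on \<kappa> {..<m}"
    by (rule inj_onI) (metis \<kappa>(2) lessThan_iff one_less_numeral_iff power_inject_exp semiring_norm(76))
  have bij_\<kappa>: "bij_betw \<kappa> {..<m} {..<m}"
    unfolding bij_betw_def using inj_\<kappa> endo_inj_surj[OF _ _ inj_\<kappa>] \<kappa>(1) by blast
  have bij_rev: "bij_betw (\<lambda>j. m - 1 - j) {..<m} {..<m}"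
    by (rule bij_betw_byWitness[where f' = "\<lambda>j. m - 1 - j"]) auto
  \<comment> \<open>Column \<open>\<kappa> j\<close> carries the digit of weight
    \<open>2 ^ j\<close>, which \<open>nbc\<close>, with its most significant bit first, keeps in
    column \<open>m - 1 - j\<close>. Outside the range \<open>\<pi>\<close> is the identity, as
    \<open>permutes\<close> demands.\<close>
  define \<pi> where "\<pi> k = (if k < m then m - 1 - the_inv_into {..<m} \<kappa> k else k)" for k
  have \<pi>: "\<pi> permutes {..<m}"
  proof (rule bij_imp_permutes)
    have "bij_betw ((\<lambda>j. m - 1 - j) \<circ> the_inv_into {..<m} \<kappa>) {..<m} {..<m}"
      by (rule bij_betw_trans[OF bij_betw_the_inv_into[OF bij_\<kappa>] bij_rev])
    then show "bij_betw \<pi> {..<m} {..<m}"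
      by (rule bij_betw_cong[THEN iffD1, rotated]) (simp add: \<pi>_def)
  qed (simp add: \<pi>_def)
  have "L = complement_columns S (permute_columns \<pi> (nbc m))"
  proof (rule eq_transformed_nbc_iff[OF len \<pi>, THEN iffD2], intro allI impI)
    fix i k :: nat assume i: "i < 2 ^ m" and k: "k < m"
    let ?T = "{j\<in>{..<m}. bit i j}"
    have "sum \<beta> (\<kappa> ` ?T) = (\<Sum>j\<in>?T. 2 ^ j)"
      using \<kappa> inj_on_subset[OF inj_\<kappa>, of ?T] by (subst sum.reindex) (auto intro!: sum.cong)
    also have "\<dots> = (\<Sum>j<m. if bit i j then 2 ^ j else 0)"
      by (rule sum.inter_filter) simp
    \<comment> \<open>Both sets have sum \<open>real i\<close>, so distinctness of subset sums
      identifies them.\<close>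
    finally have "U i = \<kappa> ` ?T"
      using sum_bits_real[OF i] sumU'[OF i] U \<kappa> by (intro inj) auto
    moreover obtain j where j: "j < m" "k = \<kappa> j"
      using bij_\<kappa> k by (metis bij_betw_imp_surj_on imageE lessThan_iff)
    ultimately have "k \<in> U i \<longleftrightarrow> bit i j"
      using inj_\<kappa> by (auto dest: inj_onD)
    moreover have "m - 1 - \<pi> k = j"
      using j k the_inv_into_f_f[OF inj_\<kappa>, of j] by (simp add: \<pi>_def)
    ultimately show "L ! i ! k \<longleftrightarrow> bit i (m - 1 - \<pi> k) \<noteq> (k \<in> S)"
      using k by (auto simp: U_def)
  qed
  moreover have "S \<subseteq> {..<m}" by (auto simp: S_def)
  ultimately show ?thesis using \<pi> by blast
qed

text \<open>The coefficients are the place values of the digits, negated in complemented columns. A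
  sign is twice its digit minus 1, so the sum is \<open>2 * i\<close> minus the total
  \<open>2 ^ m - 1\<close> of the place values.\<close>

lemma transformed_nbc_affine:
  assumes \<pi>: "\<pi> permutes {..<m}"
    and L: "L = complement_columns S (permute_columns \<pi> (nbc m))"
  shows "\<exists>b. \<forall>i<2 ^ m. 2 * real i + 1 - 2 ^ m = (\<Sum>k<m. if L ! i ! k then b k else - b k)"
proof (intro exI allI impI)
  fix i :: nat assume i: "i < 2 ^ m"
  let ?b = "\<lambda>k. if k \<in> S then - (2 ^ (m - 1 - \<pi> k)) else 2 ^ (m - 1 - \<pi> k) :: real"
  let ?g = "\<lambda>j. if bit i j then 2 ^ j else - (2 ^ j) :: real"
  have "(\<Sum>k<m. if L ! i ! k then ?b k else - ?b k) = (\<Sum>k<m. ?g (m - 1 - \<pi> k))"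
    unfolding L by (intro sum.cong refl) (auto simp: transformed_nbc_nth[OF \<pi> i])
  also have "\<dots> = (\<Sum>k<m. ?g (m - 1 - k))"
    using sum.permute[OF \<pi>, of "\<lambda>k. ?g (m - 1 - k)"] by (simp add: o_def)
  also have "\<dots> = (\<Sum>j<m. ?g j)"
    by (rule sum.reindex_bij_witness[of _ "\<lambda>j. m - 1 - j" "\<lambda>j. m - 1 - j"]) auto
  also have "\<dots> = (\<Sum>j<m. 2 * (if bit i j then 2 ^ j else 0) - 2 ^ j)"
    by (intro sum.cong) auto
  also have "\<dots> = 2 * real i - (\<Sum>j<m. 2 ^ j)"
    unfolding sum_subtractf sum_distrib_left[symmetric] sum_bits_real[OF i] ..
  also have "\<dots> = 2 * real i + 1 - 2 ^ m" by (simp add: geometric_sum)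
  finally show "2 * real i + 1 - 2 ^ m = (\<Sum>k<m. if L ! i ! k then ?b k else - ?b k)" by simp
qed

subsection \<open>Fourth moment of the fading\<close>

text \<open>A discrete layer-cake argument: \<open>h^4\<close> is at most the square of the ceiling
  of \<open>h^2\<close>, which is the sum of the odd numbers \<open>2 * n + 1\<close> over all
  \<open>n < h^2\<close>. The expectation is thus at most the sum of \<open>(2 * n + 1)\<close>
  times the probability of \<open>h^2 > n\<close>, and this converges by the tail condition.\<close>

lemma fading_law_integrable_power4:
  fixes \<nu> :: "real measure"
  assumes "fading_law \<nu> \<eta>"
  shows "integrable \<nu> (\<lambda>h. h ^ 4)"
proof -
  have \<nu>: "prob_space \<nu>" and [measurable_cong]: "sets \<nu> = sets borel"
    using assms by (auto simp: fading_law_def)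
  interpret prob_space \<nu> by fact
  obtain w where w: "w > 0"
    "\<forall>\<^sub>F \<Delta> in at_top. measure \<nu> {h. (norm h)\<^sup>2 > \<Delta>} \<le> exp (- (\<Delta> powr w))"
    using assms by (auto simp: fading_law_def)
  let ?p = "\<lambda>n. measure \<nu> {h. h\<^sup>2 > real n}"
  let ?g = "\<lambda>n h. (2 * real n + 1) * indicator {h. h\<^sup>2 > real n} h"
  have sp: "space \<nu> = UNIV"
    using sets_eq_imp_space_eq[OF \<open>sets \<nu> = sets borel\<close>] by simp
  have [measurable]: "{h. h\<^sup>2 > real n} \<in> sets \<nu>" for n
  proof -
    have "{h \<in> space \<nu>. h\<^sup>2 > real n} \<in> sets \<nu>" by measurable
    then show ?thesis by (simp add: sp)
  qed
  have ev: "\<forall>\<^sub>F n in sequentially. ?p n \<le> exp (- (real n powr w))"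
    using eventually_compose_filterlim[OF w(2) filterlim_real_sequentially] by simp
  have sum1: "summable (\<lambda>n. (2 * real n + 1) * exp (- (real n powr w)))"
  proof (rule summable_comparison_test_bigo)
    show "summable (\<lambda>n. norm (1 / real n ^ 2))"
      using inverse_power_summable[of 2, where ?'a = real] by (simp add: inverse_eq_divide)
    show "(\<lambda>n. (2 * real n + 1) * exp (- (real n powr w))) \<in> O(\<lambda>n. 1 / real n ^ 2)"
      using w(1) by real_asymp
  qed
  have sum2: "summable (\<lambda>n. (2 * real n + 1) * ?p n)"
    by (rule summable_comparison_test_ev[OF _ sum1])
      (use ev in \<open>eventually_elim, auto intro!: mult_left_mono\<close>)
  have le: "ennreal (h ^ 4) \<le> (\<Sum>n. ennreal (?g n h))" for h
  proof -
    define N where "N = nat \<lceil>h\<^sup>2\<rceil>"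
    have sumN: "(\<Sum>n<N. 2 * real n + 1) = (real N)\<^sup>2"
      by (induction N) (auto simp: power2_eq_square algebra_simps)
    have "h\<^sup>2 \<le> real N" unfolding N_def by linarith
    then have "(h\<^sup>2)\<^sup>2 \<le> (real N)\<^sup>2" by (intro power_mono) auto
    then have "h ^ 4 \<le> (\<Sum>n<N. 2 * real n + 1)" unfolding sumN by simp
    also have "\<dots> = (\<Sum>n<N. ?g n h)"
    proof (intro sum.cong refl)
      fix n assume "n \<in> {..<N}"
      then have "real n < h\<^sup>2" unfolding N_def by (simp add: zless_nat_eq_int_zless) linarith
      then show "2 * real n + 1 = ?g n h" by simp
    qed
    finally have "ennreal (h ^ 4) \<le> ennreal (\<Sum>n<N. ?g n h)" by (rule ennreal_leI)
    also have "\<dots> = (\<Sum>n<N. ennreal (?g n h))" by (rule sum_ennreal[symmetric]) auto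
    also have "\<dots> \<le> (\<Sum>n. ennreal (?g n h))" by (rule sum_le_suminf) auto
    finally show ?thesis .
  qed
  have "(\<integral>\<^sup>+h. ennreal (h ^ 4) \<partial>\<nu>) \<le> (\<integral>\<^sup>+h. (\<Sum>n. ennreal (?g n h)) \<partial>\<nu>)"
    by (intro nn_integral_mono le)
  also have "\<dots> = (\<Sum>n. \<integral>\<^sup>+h. ennreal (?g n h) \<partial>\<nu>)"
    by (rule nn_integral_suminf) measurable
  also have "\<dots> = (\<Sum>n. ennreal ((2 * real n + 1) * ?p n))"
  proof (rule suminf_cong)
    fix n
    have "(\<integral>\<^sup>+h. ennreal (?g n h) \<partial>\<nu>)
        = (\<integral>\<^sup>+h. ennreal (2 * real n + 1) * indicator {h. h\<^sup>2 > real n} h \<partial>\<nu>)"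
      by (intro nn_integral_cong) (auto simp: indicator_def)
    then show "(\<integral>\<^sup>+h. ennreal (?g n h) \<partial>\<nu>) = ennreal ((2 * real n + 1) * ?p n)"
      by (simp add: nn_integral_cmult_indicator emeasure_eq_measure ennreal_mult)
  qed
  also have "\<dots> < \<infinity>"
    using sum2 by (subst suminf_ennreal2) auto
  finally show ?thesis
    by (intro integrableI_bounded) auto
qed

subsection \<open>Linear symbols\<close>

definition bit_sign :: "bool list \<Rightarrow> nat \<Rightarrow> real" where
  "bit_sign c k = (if c ! k then 1 else - 1)"

text \<open>For distinct positions, flipping bit \<open>k\<close> negates every product, so the sum
  equals its own negative.\<close>

lemma sum_bit_sign_mult:
  assumes "j < m" "k < m"
  shows "(\<Sum>c\<in>codewords m. bit_sign c j * bit_sign c k) = (if j = k then 2 ^ m else 0)"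
proof (cases "j = k")
  case True
  have "bit_sign c k * bit_sign c k = 1" for c by (simp add: bit_sign_def)
  then show ?thesis using True by simp
next
  case False
  have "(\<Sum>c\<in>codewords m. bit_sign c j * bit_sign c k)
      = (\<Sum>c\<in>codewords m. bit_sign (c[k := \<not> c ! k]) j * bit_sign (c[k := \<not> c ! k]) k)"
    by (rule sum_codewords_flip[OF assms(2), symmetric])
  also have "\<dots> = (\<Sum>c\<in>codewords m. - (bit_sign c j * bit_sign c k))"
    using False assms by (intro sum.cong) (auto simp: bit_sign_def codewords_def)
  finally show ?thesis using False by (simp add: sum_negf)
qed

text \<open>The degree-one Walsh-Fourier coefficient of \<open>s\<close> at position
  \<open>k\<close>.\<close>

definition bit_correlation :: "nat \<Rightarrow> (bool list \<Rightarrow> real) \<Rightarrow> nat \<Rightarrow> real" where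
  "bit_correlation m s k = (\<Sum>c\<in>codewords m. s c * bit_sign c k) / 2 ^ m"

text \<open>Equality in Bessel's inequality for the orthonormal signs: the difference of the two
  sides is the mean squared distance of \<open>s\<close> from its projection \<open>?A\<close>, and
  this vanishes exactly when \<open>s\<close> lies in the span of the signs.\<close>

lemma sum_bit_correlation_squares_eq_iff:
  "(\<Sum>k<m. (bit_correlation m s k)\<^sup>2) = (\<Sum>c\<in>codewords m. (s c)\<^sup>2) / 2 ^ m
    \<longleftrightarrow> (\<exists>b. \<forall>c\<in>codewords m. s c = (\<Sum>k<m. b k * bit_sign c k))"
proof -
  let ?C = "codewords m"
  define a where "a = bit_correlation m s"
  let ?A = "\<lambda>c. \<Sum>k<m. a k * bit_sign c k"
  have corr: "(\<Sum>c\<in>?C. s c * bit_sign c k) = 2 ^ m * a k" for k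
    by (simp add: a_def bit_correlation_def)
  have cross: "(\<Sum>c\<in>?C. s c * ?A c) = 2 ^ m * (\<Sum>k<m. (a k)\<^sup>2)"
  proof -
    have "(\<Sum>c\<in>?C. s c * ?A c) = (\<Sum>k<m. \<Sum>c\<in>?C. a k * (s c * bit_sign c k))"
      by (subst sum.swap) (simp add: sum_distrib_left mult_ac)
    also have "\<dots> = 2 ^ m * (\<Sum>k<m. (a k)\<^sup>2)"
      unfolding sum_distrib_left[symmetric] corr
      by (simp add: sum_distrib_left power2_eq_square mult_ac)
    finally show ?thesis .
  qed
  have square: "(\<Sum>c\<in>?C. (\<Sum>k<m. b k * bit_sign c k) * (\<Sum>k<m. d k * bit_sign c k))
      = 2 ^ m * (\<Sum>k<m. b k * d k)" for b d :: "nat \<Rightarrow> real"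
  proof -
    have "(\<Sum>c\<in>?C. (\<Sum>k<m. b k * bit_sign c k) * (\<Sum>k<m. d k * bit_sign c k))
        = (\<Sum>c\<in>?C. \<Sum>j<m. \<Sum>k<m. b j * d k * (bit_sign c j * bit_sign c k))"
      by (simp add: sum_product mult_ac)
    also have "\<dots> = (\<Sum>j<m. \<Sum>c\<in>?C. \<Sum>k<m. b j * d k * (bit_sign c j * bit_sign c k))"
      by (rule sum.swap)
    also have "\<dots> = (\<Sum>j<m. \<Sum>k<m. \<Sum>c\<in>?C. b j * d k * (bit_sign c j * bit_sign c k))"
      by (intro sum.cong refl sum.swap)
    also have "\<dots> = (\<Sum>j<m. \<Sum>k<m. b j * d k * (if j = k then 2 ^ m else 0))"
      unfolding sum_distrib_left[symmetric]
      by (intro sum.cong refl arg_cong2[where f = "(*)"] sum_bit_sign_mult) auto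
    also have "\<dots> = 2 ^ m * (\<Sum>k<m. b k * d k)"
      by (simp add: sum_distrib_left if_distrib mult_ac cong: if_cong)
    finally show ?thesis .
  qed
  have "(\<Sum>c\<in>?C. (s c - ?A c)\<^sup>2)
      = (\<Sum>c\<in>?C. (s c)\<^sup>2) - 2 * (\<Sum>c\<in>?C. s c * ?A c) + (\<Sum>c\<in>?C. ?A c * ?A c)"
    by (simp add: power2_diff sum.distrib sum_subtractf sum_distrib_left power2_eq_square algebra_simps)
  also have "\<dots> = (\<Sum>c\<in>?C. (s c)\<^sup>2) - 2 ^ m * (\<Sum>k<m. (a k)\<^sup>2)"
    unfolding cross square by (simp add: power2_eq_square)
  finally have residual: "(\<Sum>c\<in>?C. (s c - ?A c)\<^sup>2) = (\<Sum>c\<in>?C. (s c)\<^sup>2) - 2 ^ m * (\<Sum>k<m. (a k)\<^sup>2)" .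
  show ?thesis
    unfolding a_def[symmetric]
  proof
    assume "(\<Sum>k<m. (a k)\<^sup>2) = (\<Sum>c\<in>?C. (s c)\<^sup>2) / 2 ^ m"
    then have "(\<Sum>c\<in>?C. (s c - ?A c)\<^sup>2) = 0" unfolding residual by simp
    then have "\<forall>c\<in>?C. s c = ?A c" by (simp add: sum_nonneg_eq_0_iff)
    then show "\<exists>b. \<forall>c\<in>?C. s c = (\<Sum>k<m. b k * bit_sign c k)" by blast
  next
    assume "\<exists>b. \<forall>c\<in>?C. s c = (\<Sum>k<m. b k * bit_sign c k)"
    then obtain b where b: "\<And>c. c \<in> ?C \<Longrightarrow> s c = (\<Sum>k<m. b k * bit_sign c k)" by blast
    \<comment> \<open>By orthogonality, the coefficients of any linear representation are the
      correlations, so the projection is \<open>s\<close> itself.\<close>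
    have a: "a j = b j" if "j < m" for j
    proof -
      have "2 ^ m * a j = (\<Sum>c\<in>?C. \<Sum>k<m. b k * (bit_sign c k * bit_sign c j))"
        unfolding corr[symmetric] by (intro sum.cong refl) (simp add: b sum_distrib_right mult.assoc)
      also have "\<dots> = (\<Sum>k<m. b k * (\<Sum>c\<in>?C. bit_sign c k * bit_sign c j))"
        by (subst sum.swap) (simp add: sum_distrib_left)
      also have "\<dots> = (\<Sum>k<m. b k * (if k = j then 2 ^ m else 0))"
        by (intro sum.cong refl arg_cong2[where f = "(*)"] sum_bit_sign_mult) (use that in auto)
      also have "\<dots> = 2 ^ m * b j"
        using that by (simp add: if_distrib mult_ac cong: if_cong)
      finally show ?thesis by simp
    qed
    have "s c = ?A c" if "c \<in> ?C" for c
      unfolding b[OF that] by (intro sum.cong refl) (simp add: a)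
    then have "(\<Sum>c\<in>?C. (s c - ?A c)\<^sup>2) = 0" by simp
    then show "(\<Sum>k<m. (a k)\<^sup>2) = (\<Sum>c\<in>?C. (s c)\<^sup>2) / 2 ^ m"
      unfolding residual by (simp add: field_simps)
  qed
qed

subsection \<open>First-order optimality\<close>

text \<open>For a fixed gain \<open>h\<close> the received means are \<open>h\<close> times the
  symbols, bounded by \<open>\<bar>h\<bar> * B\<close>. The bit expansion then has main term
  \<open>h^2 * (?a k)^2 / N0\<close> and error of order \<open>h^4 / N0^2\<close>; both are
  integrated over the fading.\<close>

lemma bicm_capacity_expansion:
  fixes \<nu> :: "real measure" and X :: "real list"
  assumes "fading_law \<nu> \<eta>"
  shows "\<exists>K. \<forall>N0>0. \<bar>bicm_capacity m X L \<nu> N0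
    - (\<integral>t. t\<^sup>2 \<partial>\<eta>) * (\<Sum>k<m. (bit_correlation m (symbol X L) k)\<^sup>2) / (ln 2 * N0)\<bar> \<le> K / N0\<^sup>2"
proof -
  have \<nu>: "prob_space \<nu>" "sets \<nu> = sets borel" and \<eta>: "distr \<nu> borel (\<lambda>h. h) = \<eta>"
    and int\<eta>: "integrable \<eta> (\<lambda>t. t\<^sup>2)"
    using assms by (auto simp: fading_law_def)
  note [measurable_cong] = \<nu>(2)
  let ?C = "codewords m" and ?s = "symbol X L"
  define B where "B = (\<Sum>c\<in>?C. \<bar>?s c\<bar>)"
  define V where "V = (\<integral>t. t\<^sup>2 \<partial>\<eta>)"
  define K where "K = (1440 * exp 12 + ln (real (card ?C)) + 2) * B ^ 4"
  have int2: "integrable \<nu> (\<lambda>h. h\<^sup>2)" and V: "V = (\<integral>h. h\<^sup>2 \<partial>\<nu>)"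
    using int\<eta> unfolding V_def \<eta>[symmetric] by (simp_all add: integrable_distr_eq integral_distr)
  have int4: "integrable \<nu> (\<lambda>h. h ^ 4)" by (rule fading_law_integrable_power4[OF assms])
  let ?a = "bit_correlation m ?s"
  define J where "J N0 k h = bit_information N0 ?C (\<lambda>c. c ! k) (\<lambda>c. h * ?s c)" for N0 k h
  have bound: "\<bar>(\<integral>h. J N0 k h \<partial>\<nu>) - V * (?a k)\<^sup>2 / N0\<bar> \<le> K * (\<integral>h. h ^ 4 \<partial>\<nu>) / N0\<^sup>2"
    if N0: "N0 > 0" and k: "k < m" for N0 k
  proof -
    have intJ: "integrable \<nu> (J N0 k)"
      unfolding J_def by (rule integrable_bit_information_fading[OF \<nu> N0])
    have pw: "\<bar>J N0 k h - h\<^sup>2 * (?a k)\<^sup>2 / N0\<bar> \<le> K * h ^ 4 / N0\<^sup>2" for h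
    proof -
      have "\<bar>h * ?s c\<bar> \<le> \<bar>h\<bar> * B" if "c \<in> ?C" for c
        unfolding abs_mult B_def using that
        by (intro mult_left_mono member_le_sum) auto
      then have "\<bar>J N0 k h - ((\<Sum>c\<in>?C. (if c ! k then h * ?s c else - (h * ?s c))) / card ?C)\<^sup>2 / N0\<bar>
          \<le> (1440 * exp 12 + ln (real (card ?C)) + 2) * ((\<bar>h\<bar> * B)\<^sup>2 / N0)\<^sup>2"
        unfolding J_def
        by (intro bit_information_expansion N0 card_codewords_bit[OF k]) auto
      also have "(\<Sum>c\<in>?C. (if c ! k then h * ?s c else - (h * ?s c))) / card ?C = h * ?a k"
        by (simp add: bit_correlation_def bit_sign_def sum_distrib_left if_distrib mult_ac cong: if_cong)
      also have "((\<bar>h\<bar> * B)\<^sup>2 / N0)\<^sup>2 = B ^ 4 * h ^ 4 / N0\<^sup>2"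
        by (simp add: power_divide power_mult_distrib)
      finally show ?thesis by (simp add: K_def power_mult_distrib)
    qed
    have "(\<integral>h. J N0 k h \<partial>\<nu>) - V * (?a k)\<^sup>2 / N0 = (\<integral>h. J N0 k h - h\<^sup>2 * (?a k)\<^sup>2 / N0 \<partial>\<nu>)"
      unfolding V using intJ int2 by simp
    moreover have "\<bar>\<dots>\<bar> \<le> (\<integral>h. K * h ^ 4 / N0\<^sup>2 \<partial>\<nu>)"
      using intJ int2 int4 pw by (intro integral_abs_bound_integral) auto
    ultimately show ?thesis by simp
  qed
  show ?thesis
  proof (intro exI allI impI)
    fix N0 :: real assume N0: "N0 > 0"
    let ?S = "\<Sum>k<m. (?a k)\<^sup>2"
    have "bicm_capacity m X L \<nu> N0 - V * ?S / (ln 2 * N0)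
        = (\<Sum>k<m. (\<integral>h. J N0 k h \<partial>\<nu>) - V * (?a k)\<^sup>2 / N0) / ln 2"
      unfolding bicm_capacity_eq[OF \<nu> N0] J_def[symmetric] using N0
      by (simp add: sum_subtractf sum_distrib_left sum_divide_distrib diff_divide_distrib mult_ac)
    also have "\<bar>\<dots>\<bar> \<le> (\<Sum>k<m. K * (\<integral>h. h ^ 4 \<partial>\<nu>) / N0\<^sup>2) / ln 2"
      unfolding abs_divide
      by (intro frac_le order.trans[OF sum_abs] sum_mono bound N0) (auto intro!: sum_nonneg simp: K_def)
    also have "\<dots> = (real m * K * (\<integral>h. h ^ 4 \<partial>\<nu>) / ln 2) / N0\<^sup>2"
      by (simp add: mult_ac)
    finally show "\<bar>bicm_capacity m X L \<nu> N0 - (\<integral>t. t\<^sup>2 \<partial>\<eta>) * ?S / (ln 2 * N0)\<bar>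
        \<le> (real m * K * (\<integral>h. h ^ 4 \<partial>\<nu>) / ln 2) / N0\<^sup>2"
      by (simp add: V_def)
  qed
qed

text \<open>Multiplication by \<open>x^2\<close> turns the asymptotic bound into
  \<open>\<bar>d\<bar> * x \<le> c * e^2\<close> for all large \<open>x\<close>, which forces
  \<open>d = 0\<close>.\<close>

lemma reciprocal_bigo_reciprocal_square_iff:
  fixes d e :: real
  assumes "e \<noteq> 0"
  shows "(\<lambda>x. d / x) \<in> O[at_top](\<lambda>x. (e / x)\<^sup>2) \<longleftrightarrow> d = 0"
proof
  assume "(\<lambda>x. d / x) \<in> O[at_top](\<lambda>x. (e / x)\<^sup>2)"
  then obtain c where c: "\<forall>\<^sub>F x in at_top. norm (d / x) \<le> c * norm ((e / x)\<^sup>2)"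
    by (auto elim: landau_o.bigE)
  show "d = 0"
  proof (rule ccontr)
    assume d: "d \<noteq> 0"
    have "\<forall>\<^sub>F x in at_top. x > max 0 (c * e\<^sup>2 / \<bar>d\<bar>)" by (rule eventually_gt_at_top)
    from eventually_happens'[OF trivial_limit_at_top_linorder eventually_conj[OF c this]]
    obtain x where x: "norm (d / x) \<le> c * norm ((e / x)\<^sup>2)" "x > max 0 (c * e\<^sup>2 / \<bar>d\<bar>)"
      by blast
    then have "x > 0" by simp
    have "\<bar>d\<bar> * x = norm (d / x) * x\<^sup>2" using \<open>x > 0\<close> by (simp add: power2_eq_square)
    also have "\<dots> \<le> c * norm ((e / x)\<^sup>2) * x\<^sup>2" by (intro mult_right_mono x) simp
    also have "\<dots> = c * e\<^sup>2" using \<open>x > 0\<close> by (simp add: power_divide)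
    also have "\<dots> < \<bar>d\<bar> * x" using x d by (simp add: divide_less_eq mult.commute)
    finally show False by simp
  qed
qed simp

text \<open>The capacity is \<open>V * S / (ln 2 * N0)\<close> up to order \<open>1 / N0^2\<close>,
  the signal-to-noise ratio is \<open>V * E / N0\<close>, and the target coefficient is
  \<open>1 / ln 2\<close>. As \<open>V * E\<close> is not zero, an error quadratic in that ratio is
  one of order \<open>1 / N0^2\<close>, so optimality amounts to \<open>S = E\<close>, the equality
  case of Bessel's inequality.\<close>

lemma bicm_FOO_iff:
  fixes \<nu> :: "real measure" and X :: "real list"
  assumes fading: "fading_law \<nu> \<eta>" and energy: "symbol_energy m X L \<noteq> 0"
  shows "bicm_FOO m X L \<nu> \<eta> \<longleftrightarrow>
    (\<exists>b. \<forall>c\<in>codewords m. symbol X L c = (\<Sum>k<m. b k * bit_sign c k))"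
proof -
  let ?C = "codewords m" and ?s = "symbol X L"
  define V where "V = (\<integral>t. t\<^sup>2 \<partial>\<eta>)"
  define E where "E = symbol_energy m X L"
  define S where "S = (\<Sum>k<m. (bit_correlation m ?s k)\<^sup>2)"
  have V: "V > 0" using fading by (auto simp: fading_law_def V_def)
  have E: "E = (\<Sum>c\<in>?C. (?s c)\<^sup>2) / 2 ^ m"
    unfolding E_def symbol_energy_def code_bits_eq by (subst integral_pmf_of_set) auto
  have "V * E \<noteq> 0" using V energy by (simp add: E_def)
  obtain K where K: "\<And>N0. N0 > 0 \<Longrightarrow> \<bar>bicm_capacity m X L \<nu> N0 - V * S / (ln 2 * N0)\<bar> \<le> K / N0\<^sup>2"
    using bicm_capacity_expansion[OF fading] unfolding V_def S_def by blast
  have rest: "(\<lambda>N0. bicm_capacity m X L \<nu> N0 - V * S / (ln 2 * N0)) \<in> O[at_top](\<lambda>N0. (V * E / N0)\<^sup>2)"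
  proof (rule bigoI)
    show "\<forall>\<^sub>F N0 in at_top. norm (bicm_capacity m X L \<nu> N0 - V * S / (ln 2 * N0))
        \<le> K / (V * E)\<^sup>2 * norm ((V * E / N0)\<^sup>2)"
      using eventually_gt_at_top[of 0]
    proof eventually_elim
      case (elim N0)
      then show ?case using K[OF elim] \<open>V * E \<noteq> 0\<close> by (simp add: power_divide)
    qed
  qed
  have "bicm_FOO m X L \<nu> \<eta> \<longleftrightarrow>
      (\<lambda>N0. bicm_capacity m X L \<nu> N0 - V * E / (ln 2 * N0)) \<in> O[at_top](\<lambda>N0. (V * E / N0)\<^sup>2)"
    unfolding bicm_FOO_def bicm_first_order_coeff_def snr_def V_def E_def log_def by simp
  also have "(\<lambda>N0. bicm_capacity m X L \<nu> N0 - V * E / (ln 2 * N0))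
      = (\<lambda>N0. (bicm_capacity m X L \<nu> N0 - V * S / (ln 2 * N0)) + (V * (S - E) / ln 2) / N0)"
    by (simp add: fun_eq_iff algebra_simps diff_divide_distrib add_divide_distrib)
  also have "\<dots> \<in> O[at_top](\<lambda>N0. (V * E / N0)\<^sup>2) \<longleftrightarrow>
      (\<lambda>N0. (V * (S - E) / ln 2) / N0) \<in> O[at_top](\<lambda>N0. (V * E / N0)\<^sup>2)"
    using sum_in_bigo(1)[OF rest] sum_in_bigo(2)[OF _ rest] by fastforce
  also have "\<dots> \<longleftrightarrow> S = E"
    unfolding reciprocal_bigo_reciprocal_square_iff[OF \<open>V * E \<noteq> 0\<close>] using V by simp
  also have "\<dots> \<longleftrightarrow> (\<exists>b. \<forall>c\<in>?C. ?s c = (\<Sum>k<m. b k * bit_sign c k))"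
    unfolding S_def E by (rule sum_bit_correlation_squares_eq_iff)
  finally show ?thesis .
qed

section \<open>Application to the PAM alphabet\<close>

lemma binary_labeling_bij:
  assumes "binary_labeling m L"
  shows "bij_betw (\<lambda>i. L ! i) {..<2 ^ m} (codewords m)"
proof -
  have L: "length L = 2 ^ m" "set L \<subseteq> codewords m" "distinct L"
    using assms by (auto simp: binary_labeling_def codewords_def)
  have "set L = codewords m"
    by (rule card_subset_eq) (use L distinct_card[OF L(3)] in auto)
  then show ?thesis
    using bij_betw_nth[OF L(3)] L by (metis atLeast0LessThan lessThan_atLeast0)
qed

lemma symbol_nth:
  assumes "distinct L" "i < length L"
  shows "symbol X L (L ! i) = X ! i"
proof -
  have "(THE j. j < length L \<and> L ! j = L ! i) = i"
    using assms nth_eq_iff_index_eq by (intro the_equality) auto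
  then show ?thesis by (simp add: symbol_def)
qed

theorem theorem14:
  fixes m M :: nat and L :: "bool list list" and \<nu> \<eta> :: "real measure"
  assumes "1 \<le> m" and "M = 2 ^ m"
    and "binary_labeling m L"
    and "fading_law \<nu> \<eta>"
  shows "bicm_FOO m (pam M) L \<nu> \<eta> \<longleftrightarrow>
    L = nbc m \<or>
    (\<exists>S \<pi>. S \<subseteq> {..<m} \<and> \<pi> permutes {..<m} \<and>
       L = complement_columns S (permute_columns \<pi> (nbc m)))"
proof -
  have L: "length L = 2 ^ m" "\<forall>c\<in>set L. length c = m" "distinct L"
    using assms(3) by (auto simp: binary_labeling_def)
  note bij = binary_labeling_bij[OF assms(3)]
  have sym: "symbol (pam M) L (L ! i) = 2 * real i + 1 - 2 ^ m" if "i < 2 ^ m" for i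
    using that L assms(2) by (simp add: symbol_nth pam_def)
  \<comment> \<open>For \<open>m \<ge> 1\<close> the first symbol \<open>1 - 2 ^ m\<close> is not
    zero, and its codeword has positive probability.\<close>
  have energy: "symbol_energy m (pam M) L \<noteq> 0"
  proof -
    have "L ! 0 \<in> codewords m" using L by (auto simp: codewords_def)
    then have "(symbol (pam M) L (L ! 0))\<^sup>2 \<le> (\<Sum>c\<in>codewords m. (symbol (pam M) L c)\<^sup>2)"
      by (intro member_le_sum) auto
    moreover have "(2::real) ^ m > 1" using assms(1) by simp
    then have "0 < (symbol (pam M) L (L ! 0))\<^sup>2"
      unfolding zero_less_power2 using sym[of 0] by simp
    ultimately have "0 < (\<Sum>c\<in>codewords m. (symbol (pam M) L c)\<^sup>2)" by linarith
    then show ?thesis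
      unfolding symbol_energy_def code_bits_eq by (subst integral_pmf_of_set) auto
  qed
  have "bicm_FOO m (pam M) L \<nu> \<eta> \<longleftrightarrow>
      (\<exists>b. \<forall>c\<in>codewords m. symbol (pam M) L c = (\<Sum>k<m. b k * bit_sign c k))"
    by (rule bicm_FOO_iff[OF assms(4) energy])
  also have "\<dots> \<longleftrightarrow>
      (\<exists>b. \<forall>i<2 ^ m. 2 * real i + 1 - 2 ^ m = (\<Sum>k<m. if L ! i ! k then b k else - b k))"
  proof -
    have "(\<Sum>k<m. b k * bit_sign c k) = (\<Sum>k<m. if c ! k then b k else - b k)" for b c
      by (intro sum.cong) (auto simp: bit_sign_def)
    moreover have "(\<forall>c\<in>codewords m. P c) \<longleftrightarrow> (\<forall>i<2 ^ m. P (L ! i))" for P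
      unfolding bij_betw_imp_surj_on[OF bij, symmetric] by auto
    ultimately show ?thesis using sym by simp
  qed
  also have "\<dots> \<longleftrightarrow> (\<exists>S \<pi>. S \<subseteq> {..<m} \<and> \<pi> permutes {..<m} \<and>
       L = complement_columns S (permute_columns \<pi> (nbc m)))" (is "?affine \<longleftrightarrow> ?transformed")
  proof
    assume ?affine
    then obtain b where
      "\<And>i. i < 2 ^ m \<Longrightarrow> 2 * real i + 1 - 2 ^ m = (\<Sum>k<m. if L ! i ! k then b k else - b k)"
      by blast
    then show ?transformed by (rule affine_labeling_imp_transformed_nbc[OF assms(3)])
  next
    assume ?transformed
    then obtain S \<pi> where "\<pi> permutes {..<m}"
      "L = complement_columns S (permute_columns \<pi> (nbc m))" by blast
    then show ?affine by (rule transformed_nbc_affine)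
  qed
  also have "\<dots> \<longleftrightarrow> L = nbc m \<or> ?transformed"
  proof -
    \<comment> \<open>The natural code is the case of no complemented column and the identity
      permutation.\<close>
    have "nbc m = complement_columns {} (permute_columns id (nbc m))"
      by (rule eq_transformed_nbc_iff[THEN iffD2]) (auto simp: nbc_def permutes_id)
    then have "?transformed" if "L = nbc m"
      using that by (intro exI[of _ "{}"] exI[of _ id]) (simp add: permutes_id)
    then show ?thesis by blast
  qed
  finally show ?thesis .
qed

end
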